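(* Let $G$ be the graph obtained from the dodecahedron graph by replacing every edge with a path of length $15$ (i.e. subdividing every edge into $15$ edges). Then $C(G)=3$, and $G$ admits a representation as a geometric graph.
   Context: The game of cops and robbers on a finite simple undirected graph $G$: first each of a finite set of cops is placed on a vertex, then the robber is placed on a vertex; in each subsequent step each cop, and then the robber, either moves to an adjacent vertex or stays. The cops win if at some step a cop occupies the robber's vertex. The cop number $C(G)$ is the minimum number of cops that can guarantee capturing the robber in finitely many steps. A geometric graph with parameter $r>0$ is a drawing of a graph whose vertex set is a finite set $V$ of points in the plane and whose edges are exactly the straight line segments between all pairs of distinct points of $V$ at Euclidean distance at most $r$; a graph admits a geometric representation if it is isomorphic to some geometric graph. *)

theory Defs
  imports "HOL-Analysis.Analysis" "Graph_Theory.Graph_Theory"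
begin

text \<open>
  A finite simple undirected graph is a \<^term>\<open>pair_graph\<close> of the theory \<open>Graph_Theory\<close>:
  a finite loopfree digraph with at most one arc per ordered pair of vertices and a symmetric
  arc relation, so that the edge \<open>uv\<close> is the pair of arcs \<open>(u, v)\<close> and \<open>(v, u)\<close>.
\<close>

section \<open>Subdivision\<close>

datatype 'a subdiv_vertex = Branch 'a | Inner 'a 'a nat

text \<open>
  The vertex at distance \<open>i\<close> from \<open>u\<close> on the path of length \<open>k\<close> that replaces the edge \<open>uv\<close>.
  The inner vertices are named after the orientation of \<open>uv\<close> from the smaller to the larger end,
  so that the point at distance \<open>i\<close> from \<open>u\<close> is the point at distance \<open>k - i\<close> from \<open>v\<close>
  (see \<open>subdiv_point_swap\<close>).
\<close>

definition subdiv_point :: "nat \<Rightarrow> 'a::linorder \<Rightarrow> 'a \<Rightarrow> nat \<Rightarrow> 'a subdiv_vertex" where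
  "subdiv_point k u v i =
    (if i = 0 then Branch u else if i = k then Branch v
     else if u < v then Inner u v i else Inner v u (k - i))"

definition subdivide_edges ::
  "nat \<Rightarrow> 'a::linorder pair_pre_digraph \<Rightarrow> 'a subdiv_vertex pair_pre_digraph" where
  "subdivide_edges k G =
    \<lparr> pverts = Branch ` pverts G \<union> {subdiv_point k u v i | u v i. (u, v) \<in> parcs G \<and> i \<le> k},
      parcs = {(subdiv_point k u v i, subdiv_point k u v (Suc i)) | u v i. (u, v) \<in> parcs G \<and> i < k}
            \<union> {(subdiv_point k u v (Suc i), subdiv_point k u v i) | u v i. (u, v) \<in> parcs G \<and> i < k} \<rparr>"

lemma subdiv_point_swap:
  assumes "u \<noteq> v" "i \<le> k" "k > 0"
  shows "subdiv_point k v u (k - i) = subdiv_point k u v i"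
  using assms by (auto simp: subdiv_point_def)

lemma subdiv_point_Suc_neq:
  assumes "u \<noteq> v" "i < k"
  shows "subdiv_point k u v i \<noteq> subdiv_point k u v (Suc i)"
  using assms by (auto simp: subdiv_point_def)

lemma pair_graph_subdivide_edges:
  fixes G :: "'a::linorder pair_pre_digraph"
  assumes "pair_graph G"
  shows "pair_graph (subdivide_edges k G)"
proof -
  interpret pair_graph G by fact
  have fin: "finite (parcs G \<times> {..k})" using pair_finite_arcs by simp
  have "{subdiv_point k u v i | u v i. (u, v) \<in> parcs G \<and> i \<le> k}
      = (\<lambda>((u, v), i). subdiv_point k u v i) ` (parcs G \<times> {..k})" by force
  hence fv: "finite (pverts (subdivide_edges k G))"
    using pair_finite_verts fin by (simp add: subdivide_edges_def)
  have sub: "parcs (subdivide_edges k G) \<subseteq> pverts (subdivide_edges k G) \<times> pverts (subdivide_edges k G)"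
    by (fastforce simp: subdivide_edges_def less_imp_le)
  show ?thesis
  proof
    show "finite (parcs (subdivide_edges k G))"
      using finite_subset[OF sub] fv by simp
    show "symmetric (with_proj (subdivide_edges k G))"
      unfolding symmetric_def with_proj_simps
      by (rule symI) (simp add: subdivide_edges_def, blast)
    show "fst e \<noteq> snd e" if "e \<in> parcs (subdivide_edges k G)" for e
    proof -
      from that obtain u v i where "(u, v) \<in> parcs G" "i < k"
        "e = (subdiv_point k u v i, subdiv_point k u v (Suc i)) \<or>
         e = (subdiv_point k u v (Suc i), subdiv_point k u v i)"
        by (auto simp: subdivide_edges_def)
      with subdiv_point_Suc_neq[of u v i k] pair_no_loops[of "(u, v)"] show ?thesis by auto
    qed
  qed (use sub fv in auto)
qed


section \<open>The dodecahedron graph\<close>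

text \<open>
  The dodecahedron graph in its presentation as the generalised Petersen graph \<open>GP(10, 2)\<close>.
  Below, \<open>dodecahedron_graph_iso\<close> shows that it is the graph of vertices and edges of the
  regular dodecahedron.
\<close>

definition dodecahedron_graph :: "nat pair_pre_digraph" where
  "dodecahedron_graph =
    (let E = (\<Union>i<10. {(i, (i + 1) mod 10), (i, 10 + i), (10 + i, 10 + (i + 2) mod 10)})
     in \<lparr> pverts = {..<20}, parcs = E \<union> E\<inverse> \<rparr>)"

lemma pair_graph_dodecahedron_graph: "pair_graph dodecahedron_graph"
proof
  show "symmetric (with_proj dodecahedron_graph)"
    unfolding symmetric_def with_proj_simps by (rule symI) (auto simp: dodecahedron_graph_def Let_def)
  show "fst e \<noteq> snd e" if "e \<in> parcs dodecahedron_graph" for e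
  proof -
    have "i \<noteq> (i + 1) mod 10" "i \<noteq> (i + 2) mod 10" if "i < 10" for i :: nat
      using that by presburger+
    with that show ?thesis by (simp add: dodecahedron_graph_def Let_def) force
  qed
qed (auto simp: dodecahedron_graph_def Let_def)

definition polytope_graph :: "'a::euclidean_space set \<Rightarrow> 'a pair_pre_digraph" where
  "polytope_graph P =
    \<lparr> pverts = {x. x extreme_point_of P},
      parcs = {(x, y). x \<noteq> y \<and> closed_segment x y edge_of P} \<rparr>"

definition golden_ratio :: real where
  "golden_ratio = (1 + sqrt 5) / 2"

text \<open>
  The vertices of the regular dodecahedron with edge length \<open>2 / golden_ratio\<close>, where
  \<open>1 / golden_ratio = golden_ratio - 1\<close>, listed in the order of the labels of
  \<^term>\<open>dodecahedron_graph\<close>.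
\<close>

definition dodecahedron_vertex :: "nat \<Rightarrow> real ^ 3" where
  "dodecahedron_vertex i = (let g = golden_ratio; h = golden_ratio - 1 in
    [vector [1, 1, 1], vector [0, h, g], vector [-1, 1, 1], vector [-g, 0, h],
     vector [-g, 0, -h], vector [-1, -1, -1], vector [0, -h, -g], vector [1, -1, -1],
     vector [g, 0, -h], vector [g, 0, h],
     vector [h, g, 0], vector [0, -h, g], vector [-h, g, 0], vector [-1, -1, 1],
     vector [-1, 1, -1], vector [-h, -g, 0], vector [0, h, -g], vector [h, -g, 0],
     vector [1, 1, -1], vector [1, -1, 1]] ! i)"

definition dodecahedron :: "(real ^ 3) set" where
  "dodecahedron = convex hull (dodecahedron_vertex ` {..<20})"


section \<open>Cops and robbers\<close>

definition stays_or_moves :: "'a pair_pre_digraph \<Rightarrow> 'a \<Rightarrow> 'a \<Rightarrow> bool" where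
  "stays_or_moves G u v \<longleftrightarrow> v = u \<or> (u, v) \<in> parcs G"

text \<open>\<open>r 0\<close> is the initial position of the robber and \<open>r n\<close> his position after step \<open>n\<close>.\<close>

definition robber_play :: "'a pair_pre_digraph \<Rightarrow> (nat \<Rightarrow> 'a) \<Rightarrow> bool" where
  "robber_play G r \<longleftrightarrow> r 0 \<in> pverts G \<and> (\<forall>n. stays_or_moves G (r n) (r (Suc n)))"

text \<open>
  A strategy \<open>\<sigma>\<close> maps the list of all positions of the robber so far to the list of the positions
  of the cops.  Against the robber's play \<open>r\<close> the cops are placed at \<open>cops_play \<sigma> r 0\<close>, which does
  not depend on \<open>r\<close>, and move to \<open>cops_play \<sigma> r (Suc n)\<close> in step \<open>n + 1\<close>, when they have seen
  \<open>r 0, \<dots>, r n\<close>.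
\<close>

definition cops_play :: "('a list \<Rightarrow> 'a list) \<Rightarrow> (nat \<Rightarrow> 'a) \<Rightarrow> nat \<Rightarrow> 'a list" where
  "cops_play \<sigma> r n = \<sigma> (map r [0..<n])"

definition legal_cops_play :: "'a pair_pre_digraph \<Rightarrow> nat \<Rightarrow> (nat \<Rightarrow> 'a list) \<Rightarrow> bool" where
  "legal_cops_play G k c \<longleftrightarrow>
    length (c 0) = k \<and> set (c 0) \<subseteq> pverts G \<and>
    (\<forall>n. list_all2 (stays_or_moves G) (c n) (c (Suc n)))"

text \<open>
  A cop can come to occupy the robber's vertex by the placement or a move of the robber
  (first disjunct) or by a move of the cop (second disjunct).
\<close>

definition robber_captured :: "(nat \<Rightarrow> 'a list) \<Rightarrow> (nat \<Rightarrow> 'a) \<Rightarrow> bool" where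
  "robber_captured c r \<longleftrightarrow> (\<exists>n. r n \<in> set (c n) \<or> r n \<in> set (c (Suc n)))"

definition cops_win :: "'a pair_pre_digraph \<Rightarrow> nat \<Rightarrow> bool" where
  "cops_win G k \<longleftrightarrow>
    (\<exists>\<sigma>. \<forall>r. robber_play G r \<longrightarrow>
      legal_cops_play G k (cops_play \<sigma> r) \<and> robber_captured (cops_play \<sigma> r) r)"

definition cop_number :: "'a pair_pre_digraph \<Rightarrow> nat" where
  "cop_number G = (LEAST k. cops_win G k)"

lemma cops_win_card:
  assumes "finite (pverts G)"
  shows "cops_win G (card (pverts G))"
proof -
  obtain vs where vs: "set vs = pverts G" "distinct vs"
    using finite_distinct_list[OF assms] by blast
  have "legal_cops_play G (card (pverts G)) (cops_play (\<lambda>_. vs) r)" for r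
    using vs distinct_card[of vs]
    by (auto simp: legal_cops_play_def cops_play_def list_all2_conv_all_nth stays_or_moves_def)
  moreover have "robber_captured (cops_play (\<lambda>_. vs) r) r" if "robber_play G r" for r
    using that vs by (auto simp: robber_captured_def cops_play_def robber_play_def)
  ultimately show ?thesis unfolding cops_win_def by blast
qed

text \<open>The minimum defining the cop number of a finite graph is therefore attained.\<close>

lemma cops_win_cop_number:
  assumes "finite (pverts G)"
  shows "cops_win G (cop_number G)"
  unfolding cop_number_def using cops_win_card[OF assms] by (rule LeastI)


section \<open>Geometric graphs\<close>

definition geometric_graph :: "(real ^ 2) set \<Rightarrow> real \<Rightarrow> (real ^ 2) pair_pre_digraph" where
  "geometric_graph V r =
    \<lparr> pverts = V, parcs = {(x, y). x \<in> V \<and> y \<in> V \<and> x \<noteq> y \<and> dist x y \<le> r} \<rparr>"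

definition admits_geometric_representation :: "'a pair_pre_digraph \<Rightarrow> bool" where
  "admits_geometric_representation G \<longleftrightarrow>
    (\<exists>V r. finite V \<and> r > 0 \<and> digraph_iso (with_proj G) (with_proj (geometric_graph V r)))"

lemma digraph_iso_with_proj_iff:
  assumes "pair_wf_digraph G"
  shows "digraph_iso (with_proj G) (with_proj H) \<longleftrightarrow>
    (\<exists>f. bij_betw f (pverts G) (pverts H) \<and> parcs H = map_prod f f ` parcs G)"
proof
  interpret pair_wf_digraph G by fact
  show "\<exists>f. bij_betw f (pverts G) (pverts H) \<and> parcs H = map_prod f f ` parcs G"
    if "digraph_iso (with_proj G) (with_proj H)"
  proof -
    from that obtain h where h: "digraph_isomorphism h" and eq: "with_proj H = app_iso h (with_proj G)"
      by (auto simp: digraph_iso_def)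
    have "iso_tail h = fst" "iso_head h = snd" "pverts H = iso_verts h ` pverts G"
      "parcs H = iso_arcs h ` parcs G"
      using arg_cong[OF eq, of tail] arg_cong[OF eq, of head] arg_cong[OF eq, of verts]
        arg_cong[OF eq, of arcs] by simp_all
    moreover have "iso_arcs h e = map_prod (iso_verts h) (iso_verts h) e" if "e \<in> parcs G" for e
      using h that calculation by (cases e) (auto simp: digraph_isomorphism_def prod_eq_iff)
    ultimately show ?thesis
      using h by (intro exI[of _ "iso_verts h"]) (auto simp: digraph_isomorphism_def bij_betw_def)
  qed
  show "digraph_iso (with_proj G) (with_proj H)"
    if ex: "\<exists>f. bij_betw f (pverts G) (pverts H) \<and> parcs H = map_prod f f ` parcs G"
  proof -
    from ex obtain f where f: "bij_betw f (pverts G) (pverts H)" "parcs H = map_prod f f ` parcs G"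
      by blast
    let ?h = "\<lparr> iso_verts = f, iso_arcs = map_prod f f, iso_head = snd, iso_tail = fst \<rparr>"
    have "parcs G \<subseteq> pverts G \<times> pverts G"
      using wellformed' by auto
    hence "inj_on (map_prod f f) (parcs G)"
      using f(1) map_prod_inj_on inj_on_subset by (metis bij_betw_def)
    hence "digraph_isomorphism ?h"
      using f(1) wf_digraph by (auto simp: digraph_isomorphism_def bij_betw_def)
    moreover have "with_proj H = app_iso ?h (with_proj G)"
      using f by (auto simp: app_iso_def with_proj_def bij_betw_def)
    ultimately show ?thesis unfolding digraph_iso_def by blast
  qed
qed

section \<open>The dodecahedron graph is the graph of the regular dodecahedron\<close>

lemma face_of_convex_hull_maximal:
  fixes a :: "'a::euclidean_space"
  assumes "finite S" "\<And>z. z \<in> S \<Longrightarrow> a \<bullet> z \<le> b"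
  shows "convex hull {z \<in> S. a \<bullet> z = b} face_of convex hull S"
proof -
  have "convex hull S \<subseteq> {z. a \<bullet> z \<le> b}"
    using assms(2) by (intro hull_minimal) (auto simp: convex_halfspace_le)
  then have face: "(convex hull S \<inter> {z. a \<bullet> z = b}) face_of convex hull S"
    by (intro face_of_Int_supporting_hyperplane_le) auto
  then obtain S' where S': "S' \<subseteq> S" "convex hull S \<inter> {z. a \<bullet> z = b} = convex hull S'"
    using face_of_convex_hull_subset[OF finite_imp_compact[OF assms(1)]] by blast
  have "S' \<subseteq> {z \<in> S. a \<bullet> z = b}"
    using S' hull_subset[of S' convex] by blast
  moreover have "convex hull {z \<in> S. a \<bullet> z = b} \<subseteq> convex hull S \<inter> {z. a \<bullet> z = b}"
    by (intro Int_greatest hull_mono hull_minimal) (auto simp: convex_hyperplane)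
  ultimately show ?thesis
    using face S'(2) hull_mono[of S' _ convex] by (metis subset_antisym)
qed

lemma golden_ratio_square: "golden_ratio * golden_ratio = golden_ratio + 1"
  by (simp add: golden_ratio_def field_simps)

lemma golden_ratio_bounds: "1.6 < golden_ratio" "golden_ratio < 1.7"
proof -
  have "2.2 < sqrt 5" "sqrt 5 < 2.4"
    by (rule real_less_rsqrt, simp add: power2_eq_square)
       (rule real_less_lsqrt, simp_all add: power2_eq_square)
  thus "1.6 < golden_ratio" "golden_ratio < 1.7" by (simp_all add: golden_ratio_def)
qed

text \<open>
  Exact arithmetic with vectors over the ring \<open>\<int>[\<phi>]\<close>, where \<open>\<phi>\<close> is the golden ratio and the pair
  \<open>(a, b)\<close> stands for \<open>a + b * \<phi>\<close>.
\<close>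

type_synonym golden = "int \<times> int"

definition golden_value :: "golden \<Rightarrow> real" where
  "golden_value x = of_int (fst x) + of_int (snd x) * golden_ratio"

definition golden_add :: "golden \<Rightarrow> golden \<Rightarrow> golden" where
  "golden_add x y = (fst x + fst y, snd x + snd y)"

definition golden_mult :: "golden \<Rightarrow> golden \<Rightarrow> golden" where
  "golden_mult x y =
    (fst x * fst y + snd x * snd y, fst x * snd y + snd x * fst y + snd x * snd y)"

fun golden_vector :: "golden \<times> golden \<times> golden \<Rightarrow> real ^ 3" where
  "golden_vector (x, y, z) = vector [golden_value x, golden_value y, golden_value z]"

fun golden_vector_add ::
  "golden \<times> golden \<times> golden \<Rightarrow> golden \<times> golden \<times> golden \<Rightarrow> golden \<times> golden \<times> golden" where
  "golden_vector_add (x, y, z) (x', y', z') = (golden_add x x', golden_add y y', golden_add z z')"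

fun golden_vector_scale :: "golden \<Rightarrow> golden \<times> golden \<times> golden \<Rightarrow> golden \<times> golden \<times> golden" where
  "golden_vector_scale c (x, y, z) = (golden_mult c x, golden_mult c y, golden_mult c z)"

fun golden_inner :: "golden \<times> golden \<times> golden \<Rightarrow> golden \<times> golden \<times> golden \<Rightarrow> golden" where
  "golden_inner (x, y, z) (x', y', z') =
    golden_add (golden_add (golden_mult x x') (golden_mult y y')) (golden_mult z z')"

lemma golden_value_add: "golden_value (golden_add x y) = golden_value x + golden_value y"
  by (simp add: golden_value_def golden_add_def algebra_simps)

lemma golden_value_mult: "golden_value (golden_mult x y) = golden_value x * golden_value y"
proof -
  have "golden_value x * golden_value y = of_int (fst x * fst y)
      + of_int (fst x * snd y + snd x * fst y) * golden_ratio
      + of_int (snd x * snd y) * (golden_ratio * golden_ratio)"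
    by (simp add: golden_value_def algebra_simps)
  then show ?thesis
    unfolding golden_ratio_square by (simp add: golden_value_def golden_mult_def algebra_simps)
qed

lemma golden_vector_add: "golden_vector (golden_vector_add u v) = golden_vector u + golden_vector v"
  by (cases u; cases v) (simp add: vec_eq_iff forall_3 golden_value_add)

lemma golden_vector_scale:
  "golden_vector (golden_vector_scale c u) = golden_value c *\<^sub>R golden_vector u"
  by (cases u) (simp add: vec_eq_iff forall_3 golden_value_mult)

lemma golden_inner: "golden_value (golden_inner u v) = golden_vector u \<bullet> golden_vector v"
  by (cases u; cases v) (simp add: inner_vec_def sum_3 golden_value_add golden_value_mult)

definition dodecahedron_coords :: "(golden \<times> golden \<times> golden) list" where
  "dodecahedron_coords =
    [((1, 0), (1, 0), (1, 0)), ((0, 0), (-1, 1), (0, 1)), ((-1, 0), (1, 0), (1, 0)),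
     ((0, -1), (0, 0), (-1, 1)), ((0, -1), (0, 0), (1, -1)), ((-1, 0), (-1, 0), (-1, 0)),
     ((0, 0), (1, -1), (0, -1)), ((1, 0), (-1, 0), (-1, 0)), ((0, 1), (0, 0), (1, -1)),
     ((0, 1), (0, 0), (-1, 1)), ((-1, 1), (0, 1), (0, 0)), ((0, 0), (1, -1), (0, 1)),
     ((1, -1), (0, 1), (0, 0)), ((-1, 0), (-1, 0), (1, 0)), ((-1, 0), (1, 0), (-1, 0)),
     ((1, -1), (0, -1), (0, 0)), ((0, 0), (-1, 1), (0, -1)), ((-1, 1), (0, -1), (0, 0)),
     ((1, 0), (1, 0), (-1, 0)), ((1, 0), (-1, 0), (1, 0))]"

lemma All_less_20:
  "(\<forall>i<20. P i) \<longleftrightarrow> P 0 \<and> P 1 \<and> P 2 \<and> P 3 \<and> P 4 \<and> P 5 \<and> P 6 \<and> P 7 \<and> P 8 \<and> P 9 \<and> P 10 \<and>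
    P 11 \<and> P 12 \<and> P 13 \<and> P 14 \<and> P 15 \<and> P 16 \<and> P 17 \<and> P 18 \<and> P (19 :: nat)"
  by (simp add: numeral_eq_Suc All_less_Suc2)

lemma dodecahedron_vertex_eq:
  assumes "i < 20"
  shows "dodecahedron_vertex i = golden_vector (dodecahedron_coords ! i)"
proof -
  have "\<forall>i<20. dodecahedron_vertex i = golden_vector (dodecahedron_coords ! i)"
    unfolding All_less_20
    by (simp add: dodecahedron_vertex_def dodecahedron_coords_def Let_def golden_value_def)
  with assms show ?thesis by blast
qed

definition dodecahedron_inner :: "nat \<Rightarrow> nat \<Rightarrow> golden" where
  "dodecahedron_inner i j = golden_inner (dodecahedron_coords ! i) (dodecahedron_coords ! j)"

definition dodecahedron_arcs :: "(nat \<times> nat) list" where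
  "dodecahedron_arcs =
    (let E = concat (map (\<lambda>i. [(i, (i + 1) mod 10), (i, 10 + i), (10 + i, 10 + (i + 2) mod 10)]) [0..<10])
     in E @ map prod.swap E)"

lemma parcs_dodecahedron_graph: "parcs dodecahedron_graph = set dodecahedron_arcs"
  unfolding dodecahedron_arcs_def dodecahedron_graph_def Let_def by force
lemma dodecahedron_inner_arcs: "list_all (\<lambda>(i, j). dodecahedron_inner i j = (-1, 2)) dodecahedron_arcs"
  by code_simp
lemma dodecahedron_inner_cases:
  "\<forall>i\<in>set [0..<20]. \<forall>j\<in>set [0..<20].
    if i = j then dodecahedron_inner i j = (3, 0)
    else dodecahedron_inner i j \<in> set [(-1, 2), (1, 0), (-1, 0), (1, -2), (-3, 0)]"
  by code_simp

text \<open>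
  For non-adjacent \<open>i\<close> and \<open>j\<close>, four labels \<open>p, q, s, t\<close> with \<open>p \<notin> {i, j}\<close> such that the vertices satisfy
  \<open>i + j = (\<phi> - 1) (p + q) + (2 - \<phi>) (s + t)\<close>, so that the segment from \<open>i\<close> to \<open>j\<close> is not a face.
  They are listed for \<open>i = 0\<close> and \<open>i = 10\<close>; the other cases arise by the rotation of the labels.
\<close>

definition dodecahedron_rotate :: "nat \<Rightarrow> nat \<Rightarrow> nat" where
  "dodecahedron_rotate k i =
    (if i < 10 then if i + k < 10 then i + k else i + k - 10
     else if i + k < 20 then i + k else i + k - 10)"

definition dodecahedron_witness :: "nat \<Rightarrow> nat \<Rightarrow> nat list" where
  "dodecahedron_witness i j = map (dodecahedron_rotate (if i < 10 then i else i - 10)) (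
    (if i < 10
     then [[], [], [1, 1, 10, 12], [1, 1, 3, 16], [1, 2, 6, 16], [1, 4, 7, 8], [1, 6, 8, 18], [1, 8, 7, 8], [9, 9, 10, 18], [], [], [1, 1, 9, 19], [1, 10, 10, 12], [1, 1, 5, 19], [1, 10, 14, 16], [1, 5, 9, 19], [1, 18, 16, 18], [1, 7, 9, 19], [8, 10, 0, 10], [1, 9, 9, 19]]
     else [[], [0, 0, 2, 12], [0, 12, 2, 12], [0, 2, 4, 14], [0, 14, 4, 14], [0, 4, 6, 16], [0, 16, 6, 16], [0, 6, 8, 18], [0, 18, 8, 18], [0, 0, 8, 18], [], [0, 0, 2, 15], [], [0, 1, 4, 5], [12, 12, 16, 18], [0, 3, 6, 7], [12, 18, 16, 18], [0, 5, 8, 9], [], [0, 0, 6, 19]]) ! dodecahedron_rotate (if i < 10 then 10 - i else 20 - i) j)"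

definition dodecahedron_witness_ok :: "nat \<Rightarrow> nat \<Rightarrow> nat list \<Rightarrow> bool" where
  "dodecahedron_witness_ok i j w =
    (case w of [p, q, s, t] \<Rightarrow>
      p \<noteq> i \<and> p \<noteq> j \<and> p < 20 \<and> q < 20 \<and> s < 20 \<and> t < 20 \<and>
      (let c = (\<lambda>i. dodecahedron_coords ! i)
       in golden_vector_add (c i) (c j) =
         golden_vector_add (golden_vector_scale (-1, 1) (golden_vector_add (c p) (c q)))
           (golden_vector_scale (2, -1) (golden_vector_add (c s) (c t)))) | _ \<Rightarrow> False)"

lemma dodecahedron_coords_witness:
  "\<forall>i\<in>set [0..<20]. \<forall>j\<in>set [Suc i..<20].
    if dodecahedron_inner i j = (-1, 2) then (i, j) \<in> set dodecahedron_arcs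
    else dodecahedron_witness_ok i j (dodecahedron_witness i j)"
  by code_simp

lemma dodecahedron_vertex_inner:
  assumes "i < 20" "j < 20"
  shows "dodecahedron_vertex i \<bullet> dodecahedron_vertex j = golden_value (dodecahedron_inner i j)"
  using assms by (simp add: dodecahedron_vertex_eq golden_inner dodecahedron_inner_def)

lemma dodecahedron_vertex_inner_same:
  assumes "i < 20"
  shows "dodecahedron_vertex i \<bullet> dodecahedron_vertex i = 3"
proof -
  have "i \<in> set [0..<20]" using assms by simp
  then have "dodecahedron_inner i i = (3, 0)"
    using dodecahedron_inner_cases by presburger
  with assms show ?thesis by (simp add: dodecahedron_vertex_inner golden_value_def)
qed

lemma dodecahedron_vertex_inner_le:
  assumes "i < 20" "j < 20" "i \<noteq> j"
  shows "dodecahedron_vertex i \<bullet> dodecahedron_vertex j \<le> 2 * golden_ratio - 1"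
proof -
  have "i \<in> set [0..<20]" "j \<in> set [0..<20]" using assms by simp_all
  then have "dodecahedron_inner i j \<in> set [(-1, 2), (1, 0), (-1, 0), (1, -2), (-3, 0)]"
    using dodecahedron_inner_cases assms(3) by presburger
  with assms show ?thesis
    using golden_ratio_bounds by (auto simp: dodecahedron_vertex_inner golden_value_def)
qed

lemma dodecahedron_vertex_eq_iff:
  assumes "i < 20" "j < 20"
  shows "dodecahedron_vertex i = dodecahedron_vertex j \<longleftrightarrow> i = j"
proof
  assume "dodecahedron_vertex i = dodecahedron_vertex j"
  then have "\<not> dodecahedron_vertex i \<bullet> dodecahedron_vertex j \<le> 2 * golden_ratio - 1"
    using dodecahedron_vertex_inner_same[OF assms(1)] golden_ratio_bounds by simp
  then show "i = j"
    using dodecahedron_vertex_inner_le[OF assms] by blast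
qed simp

lemma dodecahedron_graph_arcD:
  assumes "(i, j) \<in> parcs dodecahedron_graph"
  shows "i < 20" "j < 20" "i \<noteq> j"
proof -
  interpret pair_graph dodecahedron_graph by (rule pair_graph_dodecahedron_graph)
  have "pverts dodecahedron_graph = {..<20}" by (simp add: dodecahedron_graph_def Let_def)
  then show "i < 20" "j < 20" "i \<noteq> j"
    using wellformed'[OF assms] pair_no_loops[OF assms] by auto
qed

lemma dodecahedron_vertex_extreme:
  assumes "i < 20"
  shows "dodecahedron_vertex i extreme_point_of dodecahedron"
proof -
  let ?v = dodecahedron_vertex
  have le: "?v i \<bullet> ?v j < 3" if "j < 20" "j \<noteq> i" for j
    using dodecahedron_vertex_inner_le[of i j] golden_ratio_bounds assms that by simp
  have "{z \<in> ?v ` {..<20}. ?v i \<bullet> z = 3} = {?v i}"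
    using assms le dodecahedron_vertex_inner_same by fastforce
  moreover have "?v i \<bullet> z \<le> 3" if "z \<in> ?v ` {..<20}" for z
    using that assms le dodecahedron_vertex_inner_same by (fastforce simp: le_less)
  ultimately show ?thesis
    using face_of_convex_hull_maximal[of "?v ` {..<20}" "?v i" 3]
    by (simp add: dodecahedron_def face_of_singleton)
qed

lemma dodecahedron_vertex_edge:
  assumes "(i, j) \<in> parcs dodecahedron_graph"
  shows "closed_segment (dodecahedron_vertex i) (dodecahedron_vertex j) edge_of dodecahedron"
proof -
  let ?v = dodecahedron_vertex and ?b = "2 * golden_ratio + 2"
  note ij = dodecahedron_graph_arcD[OF assms]
  have inner: "?v i \<bullet> ?v j = 2 * golden_ratio - 1"
    using dodecahedron_inner_arcs assms ij
    by (auto simp: parcs_dodecahedron_graph list_all_iff dodecahedron_vertex_inner golden_value_def)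
  have lt: "(?v i + ?v j) \<bullet> ?v k < ?b" if "k < 20" "k \<noteq> i" "k \<noteq> j" for k
    using dodecahedron_vertex_inner_le[of i k] dodecahedron_vertex_inner_le[of j k]
      golden_ratio_bounds ij that by (simp add: inner_add_left)
  have eq: "(?v i + ?v j) \<bullet> ?v i = ?b" "(?v i + ?v j) \<bullet> ?v j = ?b"
    using inner inner_commute[of "?v i" "?v j"] dodecahedron_vertex_inner_same[OF ij(1)]
      dodecahedron_vertex_inner_same[OF ij(2)] by (simp_all add: inner_add_left)
  have "{z \<in> ?v ` {..<20}. (?v i + ?v j) \<bullet> z = ?b} = {?v i, ?v j}"
    using ij lt eq by fastforce
  moreover have "(?v i + ?v j) \<bullet> z \<le> ?b" if "z \<in> ?v ` {..<20}" for z
    using that lt eq by (force simp: le_less)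
  ultimately have "convex hull {?v i, ?v j} face_of dodecahedron"
    using face_of_convex_hull_maximal[of "?v ` {..<20}" "?v i + ?v j" ?b]
    by (simp add: dodecahedron_def)
  moreover have "aff_dim (convex hull {?v i, ?v j}) = 1"
    using ij by (simp add: aff_dim_convex_hull aff_dim_2 dodecahedron_vertex_eq_iff)
  ultimately show ?thesis by (simp add: edge_of_def segment_convex_hull)
qed

lemma dodecahedron_vertex_no_face:
  assumes "i < j" "j < 20" "(i, j) \<notin> parcs dodecahedron_graph"
  shows "\<not> closed_segment (dodecahedron_vertex i) (dodecahedron_vertex j) face_of dodecahedron"
proof
  let ?v = dodecahedron_vertex and ?g = golden_ratio
  let ?F = "closed_segment (?v i) (?v j)"
  assume face: "?F face_of dodecahedron"
  have "i \<in> set [0..<20]" "j \<in> set [Suc i..<20]" using assms by auto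
  then have "if dodecahedron_inner i j = (-1, 2) then (i, j) \<in> set dodecahedron_arcs
      else dodecahedron_witness_ok i j (dodecahedron_witness i j)"
    using dodecahedron_coords_witness by blast
  then have "dodecahedron_witness_ok i j (dodecahedron_witness i j)"
    using assms(3) by (simp add: parcs_dodecahedron_graph split: if_splits)
  then obtain p q s t where w: "p \<noteq> i" "p \<noteq> j" "p < 20" "q < 20" "s < 20" "t < 20"
    "golden_vector_add (dodecahedron_coords ! i) (dodecahedron_coords ! j) =
      golden_vector_add
        (golden_vector_scale (-1, 1)
          (golden_vector_add (dodecahedron_coords ! p) (dodecahedron_coords ! q)))
        (golden_vector_scale (2, -1)
          (golden_vector_add (dodecahedron_coords ! s) (dodecahedron_coords ! t)))"
    by (auto simp: dodecahedron_witness_ok_def Let_def split: list.splits)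
  have eq: "?v i + ?v j = (?g - 1) *\<^sub>R (?v p + ?v q) + (2 - ?g) *\<^sub>R (?v s + ?v t)"
    using arg_cong[OF w(7), of golden_vector] w(3-6) assms
    by (simp add: golden_vector_add golden_vector_scale dodecahedron_vertex_eq golden_value_def)
  define u where "u = (3 - ?g) / 2"
  have u: "0 < u" "u < 1" using golden_ratio_bounds by (auto simp: u_def)
  define a where "a = (?g - 1) / 2 / u"
  define b where "b = (2 - ?g) / 2 / u"
  have ab: "u * a = (?g - 1) / 2" "u * b = (2 - ?g) / 2" "0 \<le> a" "0 \<le> b"
    using u golden_ratio_bounds by (simp_all add: a_def b_def)
  have "u * (a + b + b) = u * a + u * b + u * b" by (simp add: distrib_left)
  also have "\<dots> = u" unfolding ab by (simp add: u_def field_simps)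
  finally have "u * (a + b + b) = u" .
  then have ab1: "a + b + b = 1" using u by simp
  define y where "y = a *\<^sub>R ?v q + b *\<^sub>R ?v s + b *\<^sub>R ?v t"
  have "1 - u = (?g - 1) / 2" by (simp add: u_def field_simps)
  then have "(1 - u) *\<^sub>R ?v p + u *\<^sub>R y
      = (1 / 2) *\<^sub>R ((?g - 1) *\<^sub>R (?v p + ?v q) + (2 - ?g) *\<^sub>R (?v s + ?v t))"
    by (simp add: y_def scaleR_add_right ab)
  then have mid: "midpoint (?v i) (?v j) = (1 - u) *\<^sub>R ?v p + u *\<^sub>R y"
    unfolding eq[symmetric] by (simp add: midpoint_def)
  have mem: "?v k \<in> dodecahedron" if "k < 20" for k
    using that by (simp add: dodecahedron_def hull_inc)
  have "y \<in> convex hull {?v q, ?v s, ?v t}"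
    unfolding convex_hull_3 y_def using ab(3,4) ab1 by blast
  moreover have "convex hull {?v q, ?v s, ?v t} \<subseteq> dodecahedron"
    using mem w by (intro hull_minimal) (auto simp: dodecahedron_def)
  ultimately have y: "y \<in> dodecahedron" by blast
  have pF: "?v p \<in> ?F"
  proof (cases "?v p = y")
    case True
    then have "?v p = midpoint (?v i) (?v j)" using mid by (simp add: algebra_simps)
    then show ?thesis by simp
  next
    case False
    then have "midpoint (?v i) (?v j) \<in> open_segment (?v p) y"
      using mid u by (auto simp: in_segment)
    then show ?thesis
      using face_ofD[OF face _ mem[OF w(3)] y] by simp
  qed
  then have "?v p \<in> open_segment (?v i) (?v j)"
    using w assms by (simp add: open_segment_def dodecahedron_vertex_eq_iff)
  then show False
    using dodecahedron_vertex_extreme[OF w(3)] mem[of i] mem[of j] assms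
    by (auto simp: extreme_point_of_def)
qed

theorem dodecahedron_graph_iso:
  "digraph_iso (with_proj dodecahedron_graph) (with_proj (polytope_graph dodecahedron))"
proof -
  interpret pair_graph dodecahedron_graph by (rule pair_graph_dodecahedron_graph)
  let ?v = dodecahedron_vertex
  have verts: "pverts dodecahedron_graph = {..<20}"
    by (simp add: dodecahedron_graph_def Let_def)
  have inj: "inj_on ?v {..<20}" by (auto intro!: inj_onI simp: dodecahedron_vertex_eq_iff)
  have ext: "{x. x extreme_point_of dodecahedron} = ?v ` {..<20}"
    using extreme_point_of_convex_hull dodecahedron_vertex_extreme
    by (auto simp: dodecahedron_def)
  have arc: "(i, j) \<in> parcs dodecahedron_graph"
    if ij: "i < 20" "j < 20" "i \<noteq> j" "closed_segment (?v i) (?v j) face_of dodecahedron" for i j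
  proof (cases "i < j")
    case True
    with ij show ?thesis using dodecahedron_vertex_no_face by blast
  next
    case False
    then have "(j, i) \<in> parcs dodecahedron_graph"
      using ij dodecahedron_vertex_no_face[of j i] by (auto simp: closed_segment_commute)
    then show ?thesis using arcs_symmetric by blast
  qed
  have "parcs (polytope_graph dodecahedron) = map_prod ?v ?v ` parcs dodecahedron_graph"
  proof (intro equalityI subsetI)
    fix e assume "e \<in> parcs (polytope_graph dodecahedron)"
    then obtain x y where e: "e = (x, y)" "x \<noteq> y"
      and face: "closed_segment x y face_of dodecahedron"
      by (auto simp: polytope_graph_def edge_of_def)
    have "x extreme_point_of dodecahedron" "y extreme_point_of dodecahedron"
      using extreme_point_of_face[OF face] extreme_point_of_segment[of _ x y] by auto
    then obtain i j where "x = ?v i" "y = ?v j" "i < 20" "j < 20" using ext by blast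
    moreover from this have "(i, j) \<in> parcs dodecahedron_graph" using arc e face by blast
    ultimately show "e \<in> map_prod ?v ?v ` parcs dodecahedron_graph" using e by force
  next
    fix e assume "e \<in> map_prod ?v ?v ` parcs dodecahedron_graph"
    then obtain i j where ij: "(i, j) \<in> parcs dodecahedron_graph" "e = (?v i, ?v j)" by auto
    with dodecahedron_graph_arcD[OF ij(1)] show "e \<in> parcs (polytope_graph dodecahedron)"
      by (simp add: polytope_graph_def dodecahedron_vertex_edge dodecahedron_vertex_eq_iff)
  qed
  moreover have "bij_betw ?v (pverts dodecahedron_graph) (pverts (polytope_graph dodecahedron))"
    using inj ext verts by (simp add: bij_betw_def polytope_graph_def)
  ultimately show ?thesis
    using digraph_iso_with_proj_iff[OF pair_wf_digraph_axioms] by blast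
qed

end

theory Submission
  imports Defs
begin

text \<open>
  Two cops do not suffice: the robber runs from branch vertex to branch vertex.  Because the
  dodecahedron graph has girth five, a cop who is not at the robber's branch vertex \<open>u\<close> can reach
  at most one neighbour of \<open>u\<close> in time, so that one of the three neighbours is safe.

  Three cops suffice by the method of Aigner and Fromme.  A cop who stays on the image of the robber
  under a non-expansive map onto a walk guards all vertices that the map fixes.  He can get there in
  finite time, since the image moves on the walk with speed at most one.  Two guards confine the
  robber to a region, which the third cop cuts into smaller regions with a new guard; after four
  such steps nothing is left.

  The geometric representation is an explicit drawing with integer coordinates.
\<close>

section \<open>The game on an arbitrary graph: criteria for escape and for capture\<close>

section \<open>Cops and robbers\<close>

text \<open>The classical guarded objects are shortest paths. Here a walk needs only a labelling
  that changes by at most one along the edges meeting the robber's present region. Labels elsewhere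
  may jump, so later walks need not be geodesics of the whole graph. The first walk joins the
  antipodal vertices 11 and 16, and its labels are the distances from 11.

  Labels of branch vertices are interpolated along the subdivided edges. All certificates for the
  cops are therefore checked on the 20 vertices of the dodecahedron graph instead of the 440
  vertices of its subdivision. What the branch vertices do not account for are open edges between
  two guarded ends; there two cops hold the ends and another one sweeps the edge.

  The bounds for the cops are proved for a general edge length \<open>k\<close>, at least 3 for the
  robber's escape. The length 15 enters with the drawing, where points that are not adjacent have to
  stay more than 56 apart.\<close>

abbreviation cops_move :: "'a pair_pre_digraph \<Rightarrow> 'a list \<Rightarrow> 'a list \<Rightarrow> bool" where
  "cops_move G \<equiv> list_all2 (stays_or_moves G)"

lemma stays_or_moves_refl [simp]: "stays_or_moves G x x"
  by (simp add: stays_or_moves_def)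

lemma (in pair_graph) stays_or_moves_sym: "stays_or_moves G x y \<longleftrightarrow> stays_or_moves G y x"
  using arcs_symmetric by (auto simp: stays_or_moves_def)

lemma (in pair_wf_digraph) stays_or_moves_in_verts:
  assumes "stays_or_moves G x y" "x \<in> pverts G"
  shows "y \<in> pverts G"
  using assms in_arcsD2 by (auto simp: stays_or_moves_def)

lemma (in pair_wf_digraph) cops_move_in_verts:
  assumes "cops_move G cs cs'" "set cs \<subseteq> pverts G"
  shows "set cs' \<subseteq> pverts G"
  using assms by (induction rule: list_all2_induct) (auto dest: stays_or_moves_in_verts)

lemma cops_moveD:
  assumes "cops_move G cs cs'" "c' \<in> set cs'"
  shows "\<exists>c\<in>set cs. stays_or_moves G c c'"
  using assms by (metis in_set_conv_nth list_all2_conv_all_nth)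

subsection \<open>Escaping\<close>

lemma cops_play_prefix:
  assumes "\<And>j. j < n \<Longrightarrow> r j = r' j"
  shows "cops_play \<sigma> r n = cops_play \<sigma> r' n"
  using assms by (auto simp: cops_play_def intro!: arg_cong[of _ _ \<sigma>] map_cong)

text \<open>Legality is known only against complete plays, while the robber's play is still being
  constructed. Freezing him at \<open>r n\<close> completes the prefix to a play, and the cops'
  positions up to time \<open>Suc n\<close> depend on that prefix alone.\<close>

lemma legal_cops_play_prefix:
  assumes legal: "\<And>r. robber_play G r \<Longrightarrow> legal_cops_play G k (cops_play \<sigma> r)"
    and "r 0 \<in> pverts G" "\<And>i. i < n \<Longrightarrow> stays_or_moves G (r i) (r (Suc i))"
  shows "cops_move G (cops_play \<sigma> r n) (cops_play \<sigma> r (Suc n))"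
proof -
  let ?r = "\<lambda>i. r (min i n)"
  have "robber_play G ?r"
    using assms(2,3) by (auto simp: robber_play_def min_def Suc_le_eq not_less_eq_eq)
  then have "cops_move G (cops_play \<sigma> ?r n) (cops_play \<sigma> ?r (Suc n))"
    using legal by (auto simp: legal_cops_play_def)
  moreover have "cops_play \<sigma> ?r n = cops_play \<sigma> r n" "cops_play \<sigma> ?r (Suc n) = cops_play \<sigma> r (Suc n)"
    by (auto intro: cops_play_prefix)
  ultimately show ?thesis by simp
qed

text \<open>
  The predicate \<open>safe s cs\<close> refers to the moment after the cops' move: the robber, in state \<open>s\<close>,
  is to move next.
\<close>

lemma robber_escapes:
  fixes pos :: "'s \<Rightarrow> 'a" and safe :: "'s \<Rightarrow> 'a list \<Rightarrow> bool"
  assumes nonempty: "pverts G \<noteq> {}"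
    and start: "\<And>cs. length cs = k \<Longrightarrow> set cs \<subseteq> pverts G \<Longrightarrow>
      \<exists>s. pos s \<in> pverts G \<and> pos s \<notin> set cs \<and> (\<forall>cs'. cops_move G cs cs' \<longrightarrow> safe s cs')"
    and step: "\<And>s cs. safe s cs \<Longrightarrow> pos s \<notin> set cs \<and>
      (\<exists>s'. stays_or_moves G (pos s) (pos s') \<and> pos s' \<notin> set cs \<and>
        (\<forall>cs'. cops_move G cs cs' \<longrightarrow> safe s' cs'))"
  shows "\<not> cops_win G k"
proof
  assume "cops_win G k"
  then obtain \<sigma> where \<sigma>: "\<And>r. robber_play G r \<Longrightarrow>
      legal_cops_play G k (cops_play \<sigma> r) \<and> robber_captured (cops_play \<sigma> r) r"
    unfolding cops_win_def by blast
  from nonempty obtain v where "v \<in> pverts G" by blast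
  then have "robber_play G (\<lambda>_. v)" by (simp add: robber_play_def)
  with \<sigma> have "length (\<sigma> []) = k" "set (\<sigma> []) \<subseteq> pverts G"
    by (auto simp: legal_cops_play_def cops_play_def)
  with start obtain s0 where s0: "pos s0 \<in> pverts G" "pos s0 \<notin> set (\<sigma> [])"
    "\<And>cs'. cops_move G (\<sigma> []) cs' \<Longrightarrow> safe s0 cs'" by blast
  obtain nxt where nxt: "\<And>s cs. safe s cs \<Longrightarrow>
      stays_or_moves G (pos s) (pos (nxt s cs)) \<and> pos (nxt s cs) \<notin> set cs \<and>
      (\<forall>cs'. cops_move G cs cs' \<longrightarrow> safe (nxt s cs) cs')"
    using step by metis
  \<comment> \<open>The next state depends on all earlier positions through \<open>\<sigma>\<close>,
    so the recursion carries the whole history, newest state last.\<close>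
  define H where "H = rec_nat [s0] (\<lambda>_ h. h @ [nxt (last h) (\<sigma> (map pos h))])"
  define s where "s n = last (H n)" for n
  define r where "r n = pos (s n)" for n
  let ?c = "cops_play \<sigma> r"
  have H: "H n = map s [0..<Suc n]" for n
  proof (induction n)
    case 0
    show ?case by (simp add: s_def H_def)
  next
    case (Suc n)
    have "H (Suc n) = H n @ [s (Suc n)]" by (simp add: s_def H_def)
    with Suc show ?case by simp
  qed
  have s_Suc: "s (Suc n) = nxt (s n) (?c (Suc n))" for n
  proof -
    have "map pos (H n) = map r [0..<Suc n]" unfolding H r_def by simp
    then show ?thesis unfolding s_def cops_play_def by (simp add: H_def)
  qed
  have s_0: "s 0 = s0" by (simp add: s_def H_def)
  have next_state: "stays_or_moves G (r n) (r (Suc n)) \<and> r (Suc n) \<notin> set (?c (Suc n)) \<and>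
      (\<forall>cs'. cops_move G (?c (Suc n)) cs' \<longrightarrow> safe (s (Suc n)) cs')"
    if "safe (s n) (?c (Suc n))" for n
    using nxt[OF that] unfolding s_Suc[symmetric] r_def[symmetric] .
  \<comment> \<open>Legality of the cops' next move needs legality of the robber's moves so far,
    which in turn comes from safety; hence one joint induction.\<close>
  have safe: "safe (s n) (?c (Suc n)) \<and> r n \<notin> set (?c n) \<and>
      (\<forall>i<n. stays_or_moves G (r i) (r (Suc i)))" for n
  proof (induction n)
    case 0
    have "cops_move G (?c 0) (?c (Suc 0))"
      using \<sigma> s0(1) by (intro legal_cops_play_prefix[where k = k]) (auto simp: r_def s_0)
    then show ?case using s0 by (auto simp: r_def s_0 cops_play_def)
  next
    case (Suc n)
    then have moves: "\<forall>i<Suc n. stays_or_moves G (r i) (r (Suc i))"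
      using next_state by (auto simp: less_Suc_eq)
    then have "cops_move G (?c (Suc n)) (?c (Suc (Suc n)))"
      using \<sigma> s0(1) by (intro legal_cops_play_prefix[where k = k]) (auto simp: r_def s_0)
    with Suc moves next_state show ?case by blast
  qed
  then have "robber_play G r"
    using s0(1) by (auto simp: robber_play_def r_def s_0)
  with \<sigma> have "robber_captured ?c r" by blast
  with safe step show False by (auto simp: robber_captured_def r_def)
qed

subsection \<open>Winning positions\<close>

text \<open>Positions with the robber to move. The least fixed point provides a well-founded tree of
  responses, so every play ends in a capture although no uniform bound is recorded.\<close>

inductive wins :: "'a pair_pre_digraph \<Rightarrow> 'a list \<Rightarrow> 'a \<Rightarrow> bool" for G where
  caught: "r \<in> set cs \<Longrightarrow> wins G cs r"
| respond: "(\<And>r'. stays_or_moves G r r' \<Longrightarrow> \<exists>cs'. cops_move G cs cs' \<and> wins G cs' r')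
    \<Longrightarrow> wins G cs r"

lemma cops_move_refl [simp]: "cops_move G cs cs"
  by (simp add: list_all2_refl)

text \<open>The strategy reads the robber's positions after the initial one, hence the lists
  starting at index 1. In the inductive step the first entry selects the strategy for the rest, and
  the empty list stands for the cops' present positions.\<close>

lemma wins_strategy:
  assumes "wins G cs r"
  shows "\<exists>\<sigma>. \<sigma> [] = cs \<and> (\<forall>\<rho>. \<rho> 0 = r \<longrightarrow> (\<forall>n. stays_or_moves G (\<rho> n) (\<rho> (Suc n))) \<longrightarrow>
    (\<forall>n. cops_move G (\<sigma> (map \<rho> [1..<Suc n])) (\<sigma> (map \<rho> [1..<Suc (Suc n)]))) \<and>
    (\<exists>n. \<rho> n \<in> set (\<sigma> (map \<rho> [1..<Suc n]))))"
  using assms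
proof induction
  case (caught r cs)
  then show ?case by (intro exI[of _ "\<lambda>_. cs"]) auto
next
  case (respond r cs)
  then obtain cs' \<sigma> where \<sigma>: "\<And>r'. stays_or_moves G r r' \<Longrightarrow> cops_move G cs (cs' r')"
    "\<And>r'. stays_or_moves G r r' \<Longrightarrow> \<sigma> r' [] = cs' r'"
    "\<And>r' \<rho>. stays_or_moves G r r' \<Longrightarrow> \<rho> 0 = r' \<Longrightarrow> (\<forall>n. stays_or_moves G (\<rho> n) (\<rho> (Suc n))) \<Longrightarrow>
    (\<forall>n. cops_move G (\<sigma> r' (map \<rho> [1..<Suc n])) (\<sigma> r' (map \<rho> [1..<Suc (Suc n)]))) \<and>
    (\<exists>n. \<rho> n \<in> set (\<sigma> r' (map \<rho> [1..<Suc n])))"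
    by metis
  define \<tau> where "\<tau> l = (case l of [] \<Rightarrow> cs | r' # l' \<Rightarrow> \<sigma> r' l')" for l
  have "(\<forall>n. cops_move G (\<tau> (map \<rho> [1..<Suc n])) (\<tau> (map \<rho> [1..<Suc (Suc n)]))) \<and>
      (\<exists>n. \<rho> n \<in> set (\<tau> (map \<rho> [1..<Suc n])))"
    if \<rho>: "\<rho> 0 = r" "\<forall>n. stays_or_moves G (\<rho> n) (\<rho> (Suc n))" for \<rho>
  proof -
    let ?\<rho> = "\<lambda>n. \<rho> (Suc n)"
    have r': "stays_or_moves G r (\<rho> 1)" using \<rho> by (metis One_nat_def)
    have "[Suc 0..<Suc (Suc n)] = Suc 0 # map Suc [1..<Suc n]" for n
      by (simp add: map_Suc_upt upt_conv_Cons)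
    then have \<tau>: "\<tau> (map \<rho> [1..<Suc (Suc n)]) = \<sigma> (\<rho> 1) (map ?\<rho> [1..<Suc n])" for n
      unfolding \<tau>_def by (simp add: comp_def)
    note IH = \<sigma>(3)[OF r', of ?\<rho>]
    have "cops_move G (\<tau> (map \<rho> [1..<Suc n])) (\<tau> (map \<rho> [1..<Suc (Suc n)]))" for n
    proof (cases n)
      case 0
      then show ?thesis unfolding \<tau> using \<sigma>(1,2)[OF r'] by (simp add: \<tau>_def)
    next
      case (Suc m)
      then show ?thesis unfolding Suc \<tau> using IH \<rho> by simp
    qed
    moreover obtain n where "?\<rho> n \<in> set (\<sigma> (\<rho> 1) (map ?\<rho> [1..<Suc n]))"
      using IH \<rho> by auto
    then have "\<rho> (Suc n) \<in> set (\<tau> (map \<rho> [1..<Suc (Suc n)]))" unfolding \<tau> .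
    ultimately show ?thesis by blast
  qed
  then show ?case by (intro exI[of _ \<tau>]) (auto simp: \<tau>_def)
qed

lemma cops_winI:
  assumes "length cs = k" "set cs \<subseteq> pverts G" "\<And>r. r \<in> pverts G \<Longrightarrow> wins G cs r"
  shows "cops_win G k"
proof -
  obtain \<sigma> where \<sigma>: "\<And>r. r \<in> pverts G \<Longrightarrow> \<sigma> r [] = cs"
    "\<And>r \<rho>. r \<in> pverts G \<Longrightarrow> \<rho> 0 = r \<Longrightarrow> \<forall>n. stays_or_moves G (\<rho> n) (\<rho> (Suc n)) \<Longrightarrow>
    (\<forall>n. cops_move G (\<sigma> r (map \<rho> [1..<Suc n])) (\<sigma> r (map \<rho> [1..<Suc (Suc n)]))) \<and>
    (\<exists>n. \<rho> n \<in> set (\<sigma> r (map \<rho> [1..<Suc n])))"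
    using wins_strategy[OF assms(3)] by metis
  define \<tau> where "\<tau> l = (case l of [] \<Rightarrow> cs | r # l' \<Rightarrow> \<sigma> r l')" for l
  have "legal_cops_play G k (cops_play \<tau> \<rho>) \<and> robber_captured (cops_play \<tau> \<rho>) \<rho>"
    if "robber_play G \<rho>" for \<rho>
  proof -
    have \<rho>: "\<rho> 0 \<in> pverts G" "\<forall>n. stays_or_moves G (\<rho> n) (\<rho> (Suc n))"
      using that by (auto simp: robber_play_def)
    \<comment> \<open>In the game the cops move first, in \<open>wins\<close> the robber does: the
      cops spend step 1 at \<open>cs\<close>.\<close>
    have Suc: "cops_play \<tau> \<rho> (Suc n) = \<sigma> (\<rho> 0) (map \<rho> [1..<Suc n])" for n
      by (simp add: cops_play_def \<tau>_def upt_conv_Cons del: upt_Suc)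
    have zero: "cops_play \<tau> \<rho> 0 = cs" by (simp add: cops_play_def \<tau>_def)
    have "cops_move G (cops_play \<tau> \<rho> n) (cops_play \<tau> \<rho> (Suc n))" for n
    proof (cases n)
      case 0
      then show ?thesis unfolding 0 Suc zero using \<sigma>(1) \<rho> by simp
    next
      case (Suc m)
      show ?thesis unfolding Suc \<open>\<And>n. cops_play \<tau> \<rho> (Suc n) = _ n\<close> using \<sigma>(2) \<rho> by blast
    qed
    moreover obtain n where "\<rho> n \<in> set (cops_play \<tau> \<rho> (Suc n))"
      unfolding Suc using \<sigma>(2) \<rho> by blast
    ultimately show ?thesis
      using assms zero by (auto simp: legal_cops_play_def robber_captured_def)
  qed
  then show ?thesis unfolding cops_win_def by blast
qed

subsection \<open>Shadows\<close>

text \<open>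
  Each cop \<open>i \<in> I\<close> stays on the shadow \<open>g i r\<close> of the robber \<open>r\<close>.  The robber in \<open>T\<close> can leave \<open>T\<close>
  only through a vertex that coincides with one of its shadows, where that cop catches him.
\<close>

definition confines :: "'a pair_pre_digraph \<Rightarrow> 'a set \<Rightarrow> nat set \<Rightarrow> (nat \<Rightarrow> 'a \<Rightarrow> 'a) \<Rightarrow> bool" where
  "confines G T I g \<longleftrightarrow> (\<forall>x\<in>T. \<forall>y. stays_or_moves G x y \<longrightarrow>
    (\<forall>i\<in>I. stays_or_moves G (g i x) (g i y)) \<and> (y \<in> T \<or> (\<exists>i\<in>I. g i y = y)))"

definition shadowed :: "nat set \<Rightarrow> (nat \<Rightarrow> 'a \<Rightarrow> 'a) \<Rightarrow> 'a list \<Rightarrow> 'a \<Rightarrow> bool" where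
  "shadowed I g cs r \<longleftrightarrow> (\<forall>i\<in>I. cs ! i = g i r)"

definition secures ::
  "'a pair_pre_digraph \<Rightarrow> nat \<Rightarrow> 'a set \<Rightarrow> nat set \<Rightarrow> (nat \<Rightarrow> 'a \<Rightarrow> 'a) \<Rightarrow> bool" where
  "secures G k T I g \<longleftrightarrow> (\<forall>cs r. length cs = k \<longrightarrow> set cs \<subseteq> pverts G \<longrightarrow> r \<in> T \<longrightarrow>
    shadowed I g cs r \<longrightarrow> wins G cs r)"

text \<open>One round in which the cops in \<open>I\<close> follow their shadows, cop
  \<open>j\<close> moves freely and the others stay. If the robber leaves \<open>T\<close>, one of
  his shadows coincides with him and the cop following it captures him.\<close>

lemma wins_shadowed_step:
  assumes "confines G T I g" "I \<subseteq> {..<length cs}" "j < length cs" "j \<notin> I" "r \<in> T"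
    "shadowed I g cs r"
    and step: "\<And>r'. stays_or_moves G r r' \<Longrightarrow> r' \<in> T \<Longrightarrow> \<exists>c. stays_or_moves G (cs ! j) c \<and>
      (\<forall>cs'. cops_move G cs cs' \<longrightarrow> cs' ! j = c \<longrightarrow> shadowed I g cs' r' \<longrightarrow> wins G cs' r')"
  shows "wins G cs r"
proof (rule wins.respond)
  fix r' assume r': "stays_or_moves G r r'"
  define cs' where "cs' c = map (\<lambda>i. if i \<in> I then g i r' else if i = j then c else cs ! i)
    [0..<length cs]" for c
  have move: "cops_move G cs (cs' c)" if "stays_or_moves G (cs ! j) c" for c
    using assms(1,5,6) r' that
    by (auto simp: list_all2_conv_all_nth cs'_def confines_def shadowed_def)
  have shadow: "shadowed I g (cs' c) r'" for c
    using assms(2) by (auto simp: shadowed_def cs'_def)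
  show "\<exists>cs'. cops_move G cs cs' \<and> wins G cs' r'"
  proof (cases "r' \<in> T")
    case True
    with step[OF r'] obtain c where "stays_or_moves G (cs ! j) c"
      "\<forall>cs'. cops_move G cs cs' \<longrightarrow> cs' ! j = c \<longrightarrow> shadowed I g cs' r' \<longrightarrow> wins G cs' r'" by blast
    moreover have "cs' c ! j = c" using assms(3,4) by (simp add: cs'_def)
    ultimately show ?thesis using move shadow by blast
  next
    case False
    with assms(1,5) r' obtain i where i: "i \<in> I" "g i r' = r'"
      unfolding confines_def by blast
    then have "cs' (cs ! j) ! i = r'" "i < length (cs' (cs ! j))"
      using assms(2) by (auto simp: cs'_def)
    then have "r' \<in> set (cs' (cs ! j))" using nth_mem by blast
    with move show ?thesis by (meson stays_or_moves_refl wins.caught)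
  qed
qed

context pair_wf_digraph
begin

text \<open>The free cop follows a fixed path to \<open>p\<close> regardless of the robber, while
  the other guards keep him in \<open>T\<close>.\<close>

lemma wins_approach:
  assumes "confines G T I g" "I \<subseteq> {..<k}" "j < k" "j \<notin> I"
    and at: "\<And>cs r. length cs = k \<Longrightarrow> set cs \<subseteq> pverts G \<Longrightarrow> r \<in> T \<Longrightarrow> shadowed I g cs r \<Longrightarrow>
      cs ! j = p \<Longrightarrow> wins G cs r"
    and "(x, p) \<in> (parcs G)\<^sup>*" "length cs = k" "set cs \<subseteq> pverts G" "r \<in> T" "shadowed I g cs r" "cs ! j = x"
  shows "wins G cs r"
  using assms(6-)
proof (induction x arbitrary: cs r rule: converse_rtrancl_induct)
  case base
  then show ?case using at by blast
next
  case (step x y)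
  show ?case
  proof (rule wins_shadowed_step[OF assms(1)])
    fix r' assume "r' \<in> T"
    moreover have "stays_or_moves G (cs ! j) y"
      using step by (simp add: stays_or_moves_def)
    ultimately show "\<exists>c. stays_or_moves G (cs ! j) c \<and>
      (\<forall>cs'. cops_move G cs cs' \<longrightarrow> cs' ! j = c \<longrightarrow> shadowed I g cs' r' \<longrightarrow> wins G cs' r')"
      using step.IH step.prems cops_move_in_verts
      by (intro exI[of _ y]) (metis list_all2_lengthD)
  qed (use assms step in auto)
qed

text \<open>
  A free cop walks along \<open>P\<close> towards the robber's shadow \<open>P (L r)\<close>; as the shadow cannot jump over
  him, he reaches it before \<open>P\<close> ends.
\<close>

lemma secures_acquire:
  assumes conf: "confines G T I g" and I: "I \<subseteq> {..<k}" "j < k" "j \<notin> I"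
    and L: "\<And>x y. x \<in> T \<Longrightarrow> stays_or_moves G x y \<Longrightarrow> L x \<le> Suc (L y)" "\<And>x. x \<in> T \<Longrightarrow> L x \<le> M"
    and P: "\<And>n. n < M \<Longrightarrow> stays_or_moves G (P n) (P (Suc n))"
    and reach: "\<And>x. x \<in> pverts G \<Longrightarrow> (x, P 0) \<in> (parcs G)\<^sup>*"
    and secures: "secures G k T (insert j I) (g(j := P \<circ> L))"
  shows "secures G k T I g"
proof -
  have on_shadow: "wins G cs r"
    if "length cs = k" "set cs \<subseteq> pverts G" "r \<in> T" "shadowed I g cs r" "cs ! j = P (L r)" for cs r
  proof -
    have "shadowed (insert j I) (g(j := P \<circ> L)) cs r"
      using that I by (auto simp: shadowed_def)
    with that secures show ?thesis by (simp add: secures_def)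
  qed
  have chase: "wins G cs r"
    if "length cs = k" "set cs \<subseteq> pverts G" "r \<in> T" "shadowed I g cs r" "cs ! j = P n" "n \<le> L r" for cs r n
    using that
  proof (induction "M - n" arbitrary: n cs r rule: less_induct)
    case less
    show ?case
    proof (cases "L r = n")
      case True
      with on_shadow less show ?thesis by blast
    next
      case False
      show ?thesis
      proof (rule wins_shadowed_step[OF conf])
        fix r' assume r': "stays_or_moves G r r'" "r' \<in> T"
        have verts: "length cs' = k" "set cs' \<subseteq> pverts G" if "cops_move G cs cs'" for cs'
          using that less.prems cops_move_in_verts by (auto dest: list_all2_lengthD)
        \<comment> \<open>From \<open>n < L r\<close> the index of the shadow falls by at most one,
          hence to \<open>n\<close> at worst.\<close>
        have n: "n \<le> L r'" "n < M" using L[of r] r' False less.prems by force+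
        show "\<exists>c. stays_or_moves G (cs ! j) c \<and>
          (\<forall>cs'. cops_move G cs cs' \<longrightarrow> cs' ! j = c \<longrightarrow> shadowed I g cs' r' \<longrightarrow> wins G cs' r')"
        proof (cases "L r' = n")
          case True
          then show ?thesis
            using less.prems verts on_shadow r' by (intro exI[of _ "P n"]) auto
        next
          case False
          then show ?thesis
            using less.prems verts n P r'
            by (intro exI[of _ "P (Suc n)"]) (auto intro!: less.hyps[of "Suc n"])
        qed
      qed (use I less in auto)
    qed
  qed
  show ?thesis
    unfolding secures_def
  proof (intro allI impI)
    fix cs r assume cs: "length cs = k" "set cs \<subseteq> pverts G" "r \<in> T" "shadowed I g cs r"
    then have "(cs ! j, P 0) \<in> (parcs G)\<^sup>*" using reach I by (auto simp: subset_iff)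
    show "wins G cs r"
    proof (rule wins_approach[OF conf I _ \<open>(cs ! j, P 0) \<in> _\<close> cs refl])
      fix cs r assume "length cs = k" "set cs \<subseteq> pverts G" "r \<in> T" "shadowed I g cs r" "cs ! j = P 0"
      then show "wins G cs r" using chase[of cs r 0] by simp
    qed
  qed
qed

end

lemma confines_insert:
  assumes "confines G T I g" "j \<notin> I"
    "\<And>x y. x \<in> T \<Longrightarrow> stays_or_moves G x y \<Longrightarrow> stays_or_moves G (f x) (f y)"
  shows "confines G T (insert j I) (g(j := f))"
  unfolding confines_def
proof (intro ballI allI impI)
  fix x y assume "x \<in> T" "stays_or_moves G x y"
  with assms(1) have old: "\<forall>i\<in>I. stays_or_moves G (g i x) (g i y)" "y \<in> T \<or> (\<exists>i\<in>I. g i y = y)"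
    unfolding confines_def by blast+
  have "(g(j := f)) i = g i" if "i \<in> I" for i using that assms(2) by auto
  with old assms(3)[OF \<open>x \<in> T\<close> \<open>stays_or_moves G x y\<close>]
  show "(\<forall>i\<in>insert j I. stays_or_moves G ((g(j := f)) i x) ((g(j := f)) i y)) \<and>
      (y \<in> T \<or> (\<exists>i\<in>insert j I. (g(j := f)) i y = y))" by auto
qed

text \<open>The robber's current vertex selects the piece to continue with. Cops in \<open>I\<close>
  outside \<open>J\<close> are released there, since \<open>secures\<close> asks nothing of their
  positions.\<close>

lemma secures_cover:
  assumes "I \<subseteq> {..<k}"
    and "\<And>r. r \<in> T \<Longrightarrow> (\<exists>i\<in>I. g i r = r) \<or> (\<exists>T' J. r \<in> T' \<and> J \<subseteq> I \<and> secures G k T' J g)"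
  shows "secures G k T I g"
  unfolding secures_def
proof (intro allI impI)
  fix cs r assume cs: "length cs = k" "set cs \<subseteq> pverts G" "r \<in> T" "shadowed I g cs r"
  from assms(2)[OF \<open>r \<in> T\<close>] show "wins G cs r"
  proof
    assume "\<exists>i\<in>I. g i r = r"
    then obtain i where "i \<in> I" "cs ! i = r" using cs by (auto simp: shadowed_def)
    then have "r \<in> set cs" using cs assms(1) nth_mem[of i cs] by auto
    then show ?thesis by (rule wins.caught)
  next
    assume "\<exists>T' J. r \<in> T' \<and> J \<subseteq> I \<and> secures G k T' J g"
    then show ?thesis using cs unfolding secures_def shadowed_def by blast
  qed
qed

section \<open>Subdivisions\<close>

locale subdivision = pair_graph G for G :: "'a::linorder pair_pre_digraph" +
  fixes k :: nat
  assumes k_pos: "0 < k"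
begin

abbreviation point where "point \<equiv> subdiv_point k"
abbreviation H where "H \<equiv> subdivide_edges k G"

sublocale H: pair_graph H
  by (rule pair_graph_subdivide_edges) unfold_locales

lemma arc_neq: "(u, v) \<in> parcs G \<Longrightarrow> u \<noteq> v"
  using pair_no_loops by fastforce

lemma arc_sym: "(u, v) \<in> parcs G \<longleftrightarrow> (v, u) \<in> parcs G"
  using arcs_symmetric by blast

lemma point_ends [simp]: "point u v 0 = Branch u" "point u v k = Branch v"
  using k_pos by (auto simp: subdiv_point_def)

lemma point_swap: "(u, v) \<in> parcs G \<Longrightarrow> i \<le> k \<Longrightarrow> point v u (k - i) = point u v i"
  using arc_neq k_pos by (intro subdiv_point_swap) auto

lemma point_eq_Branch_iff: "i \<le> k \<Longrightarrow> point u v i = Branch w \<longleftrightarrow> i = 0 \<and> w = u \<or> i = k \<and> w = v"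
  using k_pos by (auto simp: subdiv_point_def)

lemma point_eq_iff:
  assumes "(u, v) \<in> parcs G" "(u', v') \<in> parcs G" "0 < i" "i < k" "j \<le> k"
  shows "point u v i = point u' v' j \<longleftrightarrow> u = u' \<and> v = v' \<and> i = j \<or> u = v' \<and> v = u' \<and> i = k - j"
  using assms arc_neq[OF assms(1)] arc_neq[OF assms(2)] by (auto simp: subdiv_point_def)

text \<open>A backward arc on \<open>uv\<close> is a forward arc on \<open>vu\<close>, so one
  orientation describes all arcs.\<close>

lemma parcs_H:
  "(x, y) \<in> parcs H \<longleftrightarrow> (\<exists>u v i. (u, v) \<in> parcs G \<and> i < k \<and> x = point u v i \<and> y = point u v (Suc i))"
    (is "_ \<longleftrightarrow> ?R")
proof
  assume "(x, y) \<in> parcs H"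
  moreover have ?R if "(u, v) \<in> parcs G" "i < k" "x = point u v (Suc i)" "y = point u v i" for u v i
  proof (intro exI conjI)
    show "(v, u) \<in> parcs G" using that arc_sym by blast
    show "k - Suc i < k" "x = point v u (k - Suc i)" "y = point v u (Suc (k - Suc i))"
      using that point_swap[of u v "Suc i"] point_swap[of u v i] by (auto simp: Suc_diff_Suc)
  qed
  ultimately show ?R unfolding subdivide_edges_def by auto
qed (auto simp: subdivide_edges_def)

lemma point_in_verts: "(u, v) \<in> parcs G \<Longrightarrow> i \<le> k \<Longrightarrow> point u v i \<in> pverts H"
  by (auto simp: subdivide_edges_def)

lemma Branch_in_verts_iff: "Branch u \<in> pverts H \<longleftrightarrow> u \<in> pverts G"
proof
  assume "Branch u \<in> pverts H"
  then show "u \<in> pverts G"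
    using in_arcsD1 in_arcsD2 by (auto simp: subdivide_edges_def subdiv_point_def split: if_splits)
qed (simp add: subdivide_edges_def)

lemma pverts_H:
  "pverts H = Branch ` pverts G \<union> {Inner u v i | u v i. (u, v) \<in> parcs G \<and> u < v \<and> 0 < i \<and> i < k}"
proof (intro equalityI subsetI)
  fix x assume "x \<in> pverts H"
  moreover have "point u v i \<in> Branch ` pverts G \<union>
      {Inner u v i | u v i. (u, v) \<in> parcs G \<and> u < v \<and> 0 < i \<and> i < k}"
    if "(u, v) \<in> parcs G" "i \<le> k" for u v i
    using that arc_neq[OF that(1)] arc_sym[of u v] in_arcsD1 in_arcsD2
    by (auto simp: subdiv_point_def)
  ultimately show "x \<in> Branch ` pverts G \<union>
      {Inner u v i | u v i. (u, v) \<in> parcs G \<and> u < v \<and> 0 < i \<and> i < k}"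
    by (auto simp: subdivide_edges_def)
next
  fix x assume "x \<in> Branch ` pverts G \<union>
    {Inner u v i | u v i. (u, v) \<in> parcs G \<and> u < v \<and> 0 < i \<and> i < k}"
  moreover have "Inner u v i = point u v i" if "u < v" "0 < i" "i < k" for u v i
    using that by (simp add: subdiv_point_def)
  ultimately show "x \<in> pverts H"
    using point_in_verts by (fastforce simp: Branch_in_verts_iff)
qed

text \<open>With \<open>i < k\<close> a branch vertex always appears as the start of an edge, and
  only there can a move change the edge.\<close>

lemma move_point:
  assumes "(u, v) \<in> parcs G" "i < k" "stays_or_moves H (point u v i) y"
  obtains (stay) "y = point u v i"
    | (forward) v' where "(u, v') \<in> parcs G" "v' = v \<or> i = 0" "y = point u v' (Suc i)"
    | (backward) "0 < i" "y = point u v (i - 1)"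
proof (cases "y = point u v i")
  case False
  with assms(3) obtain u' v' j where j: "(u', v') \<in> parcs G" "j < k" "point u v i = point u' v' j"
    "y = point u' v' (Suc j)" by (auto simp: stays_or_moves_def parcs_H)
  show ?thesis
  proof (cases "i = 0")
    case True
    then have "u' = u" "j = 0" using j point_eq_Branch_iff[of j u' v' u] by auto
    with j True forward show ?thesis by simp
  next
    case False
    then consider "u = u'" "v = v'" "i = j" | "u = v'" "v = u'" "i = k - j"
      using assms(1,2) j point_eq_iff[of u v u' v' i j] by auto
    then show ?thesis
    proof cases
      case 1
      with j forward show ?thesis by blast
    next
      case 2
      have "y = point u v (k - Suc j)"
        using 2 j point_swap[of u' v' "Suc j"] by simp
      with 2 False backward show ?thesis by simp
    qed
  qed
qed (rule stay)

lemma arc_point: "(u, v) \<in> parcs G \<Longrightarrow> i < k \<Longrightarrow> (point u v i, point u v (Suc i)) \<in> parcs H"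
  using parcs_H by blast

end

subsection \<open>The robber against fewer cops than the minimum degree\<close>

text \<open>Balls whose recursion peels off the step made first, at \<open>x\<close>: a cop outside
  the ball of radius \<open>Suc n\<close> is, after one move, still outside the ball of radius
  \<open>n\<close>.\<close>

fun near :: "'a pair_pre_digraph \<Rightarrow> nat \<Rightarrow> 'a \<Rightarrow> 'a set" where
  "near G 0 y = {y}"
| "near G (Suc n) y = {x. \<exists>z\<in>near G n y. stays_or_moves G x z}"

lemma near_Suc_subset: "near G n y \<subseteq> near G (Suc n) y"
  using stays_or_moves_refl by (fastforce simp del: stays_or_moves_refl)

text \<open>Pigeonhole: if every \<open>a\<close> were spoiled, choosing a spoiler for each would
  map \<open>A\<close> injectively into the cops.\<close>

lemma exists_avoiding:
  assumes "finite A" "length cs < card A"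
    and "\<And>c a a'. c \<in> set cs \<Longrightarrow> a \<in> A \<Longrightarrow> a' \<in> A \<Longrightarrow> c \<in> B a \<Longrightarrow> c \<in> B a' \<Longrightarrow> a = a'"
  shows "\<exists>a\<in>A. \<forall>c\<in>set cs. c \<notin> B a"
proof (rule ccontr)
  assume "\<not> ?thesis"
  then obtain f where f: "\<And>a. a \<in> A \<Longrightarrow> f a \<in> set cs \<and> f a \<in> B a" by metis
  with assms(3) have "inj_on f A" by (metis inj_onI)
  then have "card A \<le> card (set cs)" using f by (intro card_inj_on_le[of f]) auto
  then show False using assms(2) card_length[of cs] by simp
qed

context subdivision
begin

text \<open>The ball is a star: within \<open>k\<close> steps from \<open>w\<close> a walk cannot
  get beyond the other end of an edge at \<open>w\<close>.\<close>

lemma near_Branch: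
  assumes "n \<le> k" "x \<in> near H n (Branch w)"
  shows "x = Branch w \<or> (\<exists>u i. (w, u) \<in> parcs G \<and> i \<le> n \<and> x = point w u i)"
  using assms
proof (induction n arbitrary: x)
  case (Suc n)
  then obtain z where z: "z \<in> near H n (Branch w)" "stays_or_moves H z x"
    using H.stays_or_moves_sym by auto
  from Suc.IH[OF _ z(1)] Suc.prems(1) consider "z = Branch w" | u i where
    "(w, u) \<in> parcs G" "i \<le> n" "z = point w u i" by force
  then show ?case
  proof cases
    case 1
    show ?thesis
    proof (cases "x = Branch w")
      case False
      with z 1 obtain u v i where i: "(u, v) \<in> parcs G" "i < k" "Branch w = point u v i"
        "x = point u v (Suc i)" by (auto simp: stays_or_moves_def parcs_H)
      then have "u = w" "i = 0" using point_eq_Branch_iff[of i u v w] by auto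
      with i show ?thesis by (metis One_nat_def Suc_le_mono le0)
    qed simp
  next
    case 2
    have "i < k" using 2 Suc.prems by simp
    from 2(1) this z(2)[unfolded 2(3)] show ?thesis
    proof (cases rule: move_point)
      case stay
      moreover have "i \<le> Suc n" using 2 by simp
      ultimately show ?thesis using 2 by blast
    next
      case (forward v')
      moreover have "Suc i \<le> Suc n" using 2 by simp
      ultimately show ?thesis by blast
    next
      case backward
      moreover have "i - 1 \<le> Suc n" using 2 by simp
      ultimately show ?thesis using 2 by blast
    qed
  qed
qed simp

lemma point_near: "(w, u) \<in> parcs G \<Longrightarrow> i \<le> k \<Longrightarrow> point w u i \<in> near H i (Branch w)"
proof (induction i)
  case (Suc i)
  then have "stays_or_moves H (point w u i) (point w u (Suc i))" "point w u i \<in> near H i (Branch w)"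
    using arc_point[of w u i] by (simp_all add: stays_or_moves_def)
  then show ?case
    using H.stays_or_moves_sym by auto
qed simp

text \<open>An inner vertex determines its edge, so lying in both stars would make \<open>w\<close>
  and \<open>w'\<close> the two ends of one edge. Only branch vertices remain.\<close>

lemma near_Branch_inter:
  assumes "w \<noteq> w'" "(w, w') \<notin> parcs G" "x \<in> near H k (Branch w)" "x \<in> near H k (Branch w')"
  obtains v where "x = Branch v" "(w, v) \<in> parcs G" "(w', v) \<in> parcs G"
proof -
  note x = near_Branch[OF order_refl assms(3)] near_Branch[OF order_refl assms(4)]
  show ?thesis
  proof (cases x)
    case (Branch v)
    have "v = y \<or> (y, v) \<in> parcs G"
      if "x = Branch y \<or> (\<exists>u i. (y, u) \<in> parcs G \<and> i \<le> k \<and> x = point y u i)" for y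
      using that
    proof (elim disjE exE conjE)
      fix u i assume "(y, u) \<in> parcs G" "i \<le> k" "x = point y u i"
      moreover from this Branch have "i = 0 \<and> v = y \<or> i = k \<and> v = u"
        using point_eq_Branch_iff[of i y u v] by simp
      ultimately show ?thesis by blast
    qed (use Branch in simp)
    from this[OF x(1)] this[OF x(2)] show ?thesis
      using that Branch assms(1,2) arc_sym by blast
  next
    case (Inner a b j)
    with x have "\<exists>u i. (w, u) \<in> parcs G \<and> i \<le> k \<and> x = point w u i"
      "\<exists>u i. (w', u) \<in> parcs G \<and> i \<le> k \<and> x = point w' u i" by simp_all
    then obtain u i u' i' where u: "(w, u) \<in> parcs G" "i \<le> k" "x = point w u i"
      "(w', u') \<in> parcs G" "i' \<le> k" "x = point w' u' i'" by blast
    with Inner have "0 < i" "i < k" by (auto simp: subdiv_point_def split: if_splits)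
    with u point_eq_iff[of w u w' u' i i'] assms show ?thesis by auto
  qed
qed

text \<open>
  The state \<open>(u, v, j)\<close> means that the robber runs to \<open>u\<close> along the edge from \<open>v\<close> and is at
  distance \<open>j\<close> from \<open>u\<close>, while every cop is farther from \<open>u\<close>.  When he arrives at \<open>u\<close>, every cop
  is within distance \<open>k\<close> of at most one neighbour of \<open>u\<close>.
\<close>

lemma not_cops_win:
  assumes "3 \<le> k" "pverts G \<noteq> {}"
    and degree: "\<And>u. u \<in> pverts G \<Longrightarrow> m < card {v. (u, v) \<in> parcs G}"
    and no_triangle: "\<And>u v w. (u, v) \<in> parcs G \<Longrightarrow> (u, w) \<in> parcs G \<Longrightarrow> (v, w) \<notin> parcs G"
    and no_square: "\<And>u u' v w. (u, v) \<in> parcs G \<Longrightarrow> (u, w) \<in> parcs G \<Longrightarrow> (u', v) \<in> parcs G \<Longrightarrow>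
      (u', w) \<in> parcs G \<Longrightarrow> v \<noteq> w \<Longrightarrow> u = u'"
  shows "\<not> cops_win H m"
proof -
  let ?pos = "\<lambda>(u, v, j). point u v j"
  let ?safe = "\<lambda>(u, v, j) cs. (u, v) \<in> parcs G \<and> j \<le> k \<and> length cs = m \<and>
    (\<forall>c\<in>set cs. c \<notin> near H j (Branch u))"
  have fin: "finite {v. (u, v) \<in> parcs G}" for u
    by (rule finite_subset[OF _ pair_finite_verts]) (auto dest: in_arcsD2)
  have nonempty: "pverts H \<noteq> {}" using assms(2) Branch_in_verts_iff by blast
  have start: "\<exists>s. ?pos s \<in> pverts H \<and> ?pos s \<notin> set cs \<and> (\<forall>cs'. cops_move H cs cs' \<longrightarrow> ?safe s cs')"
    if cs: "length cs = m" for cs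
  proof -
    obtain u0 where "u0 \<in> pverts G" using assms(2) by blast
    have "card {v. (u0, v) \<in> parcs G} \<le> card (pverts G)"
      using in_arcsD2 by (intro card_mono) auto
    then have m: "m < card (pverts G)" using degree[OF \<open>u0 \<in> pverts G\<close>] by simp
    \<comment> \<open>Since \<open>3 \<le> k\<close>, unit balls around distinct branch vertices are
      disjoint, so each cop rules out at most one starting vertex.\<close>
    have "\<exists>u\<in>pverts G. \<forall>c\<in>set cs. c \<notin> near H 1 (Branch u)"
    proof (rule exists_avoiding)
      fix c a a' assume a: "c \<in> near H 1 (Branch a)" "c \<in> near H 1 (Branch a')"
      show "a = a'"
      proof (rule ccontr)
        assume "a \<noteq> a'"
        with near_Branch[of 1 c a] near_Branch[of 1 c a'] a assms(1) show False
          by (auto simp: subdiv_point_def le_Suc_eq split: if_splits)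
      qed
    qed (use m cs in auto)
    then obtain u where u: "u \<in> pverts G" "\<forall>c\<in>set cs. c \<notin> near H 1 (Branch u)" by blast
    then have "{v. (u, v) \<in> parcs G} \<noteq> {}" using degree[of u] by force
    then obtain v where v: "(u, v) \<in> parcs G" by blast
    have "Branch u \<notin> set cs" using u near_Suc_subset[of H 0 "Branch u"] by auto
    moreover have "Branch u \<notin> set cs'" if "cops_move H cs cs'" for cs'
      using that u(2) by (fastforce simp: list_all2_conv_all_nth in_set_conv_nth)
    \<comment> \<open>At remaining distance 0 the robber is at \<open>u\<close> itself, and any
      neighbour \<open>v\<close> completes the state.\<close>
    ultimately show ?thesis
      using u v cs by (intro exI[of _ "(u, v, 0)"])
        (auto simp: Branch_in_verts_iff dest: list_all2_lengthD)
  qed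
  have step: "?pos s \<notin> set cs \<and> (\<exists>s'. stays_or_moves H (?pos s) (?pos s') \<and> ?pos s' \<notin> set cs \<and>
      (\<forall>cs'. cops_move H cs cs' \<longrightarrow> ?safe s' cs'))" if safe: "?safe s cs" for s cs
  proof -
    obtain u v j where s: "s = (u, v, j)" by (cases s)
    have uv: "(u, v) \<in> parcs G" and j: "j \<le> k" and cs: "length cs = m"
      and far: "\<And>c. c \<in> set cs \<Longrightarrow> c \<notin> near H j (Branch u)" using safe s by auto
    have run: "?pos (u', v', j') \<notin> set cs \<and> (\<forall>cs'. cops_move H cs cs' \<longrightarrow> ?safe (u', v', j') cs')"
      if u': "(u', v') \<in> parcs G" "Suc j' \<le> k" "\<And>c. c \<in> set cs \<Longrightarrow> c \<notin> near H (Suc j') (Branch u')"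
      for u' v' j'
    proof -
      have "point u' v' j' \<in> near H (Suc j') (Branch u')"
        using point_near[of u' v' j'] u' near_Suc_subset by fastforce
      moreover have "c' \<notin> near H j' (Branch u')" if cs': "cops_move H cs cs'" "c' \<in> set cs'" for cs' c'
      proof -
        from cops_moveD[OF cs'] obtain c where "c \<in> set cs" "stays_or_moves H c c'" by blast
        then show ?thesis using u'(3)[of c] by auto
      qed
      ultimately show ?thesis
        using u' cs by (auto dest: list_all2_lengthD)
    qed
    have "?pos s \<notin> set cs" using far point_near[OF uv j] s by auto
    moreover have "\<exists>s'. stays_or_moves H (?pos s) (?pos s') \<and> ?pos s' \<notin> set cs \<and>
      (\<forall>cs'. cops_move H cs cs' \<longrightarrow> ?safe s' cs')"
    proof (cases j)
      case (Suc j')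
      then have "stays_or_moves H (point u v j) (point u v j')"
        using arc_point[OF uv, of j'] j H.stays_or_moves_sym by (auto simp: stays_or_moves_def)
      with run[of u v j'] Suc s uv j far show ?thesis by (intro exI[of _ "(u, v, j')"]) auto
    next
      case 0
      have "\<exists>w\<in>{w. (u, w) \<in> parcs G}. \<forall>c\<in>set cs. c \<notin> near H k (Branch w)"
      proof (rule exists_avoiding[OF fin])
        show "length cs < card {w. (u, w) \<in> parcs G}" using degree[of u] uv in_arcsD1 cs by auto
        fix c w w' assume c: "c \<in> set cs" "w \<in> {w. (u, w) \<in> parcs G}" "w' \<in> {w. (u, w) \<in> parcs G}"
          "c \<in> near H k (Branch w)" "c \<in> near H k (Branch w')"
        show "w = w'"
        proof (rule ccontr)
          assume "w \<noteq> w'"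
          with c no_triangle[of u w w'] obtain v where v: "c = Branch v" "(w, v) \<in> parcs G" "(w', v) \<in> parcs G"
            by (auto elim: near_Branch_inter)
          \<comment> \<open>Otherwise \<open>u\<close>, \<open>w\<close>, \<open>v\<close>,
            \<open>w'\<close> would form a four-cycle; a cop at \<open>u\<close> itself contradicts
            safety.\<close>
          with no_square[of u w w' v] c \<open>w \<noteq> w'\<close> have "v = u" using arc_sym by auto
          with v c(1) far[of c] 0 show False by simp
        qed
      qed
      then obtain w where w: "(u, w) \<in> parcs G" "\<And>c. c \<in> set cs \<Longrightarrow> c \<notin> near H k (Branch w)" by blast
      have wu: "(w, u) \<in> parcs G" using w arc_sym by blast
      have "(point w u (k - 1), point w u k) \<in> parcs H"
        using arc_point[OF wu, of "k - 1"] k_pos by simp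
      then have "stays_or_moves H (point u v j) (point w u (k - 1))"
        using 0 H.stays_or_moves_sym by (auto simp: stays_or_moves_def)
      with run[of w u "k - 1"] s wu w(2) k_pos show ?thesis
        by (intro exI[of _ "(w, u, k - 1)"]) auto
    qed
    ultimately show ?thesis by blast
  qed
  show ?thesis
    by (rule robber_escapes[where pos = ?pos and safe = ?safe, OF nonempty start step])
qed

end

subsection \<open>Shadows on walks\<close>

text \<open>
  A guard \<open>(w, l)\<close> is a walk \<open>w\<close> in \<open>G\<close> together with a labelling of the vertices by indices of
  \<open>w\<close>: the shadow of \<open>Branch u\<close> is \<open>Branch (w ! l u)\<close>, and along the edges the shadow moves with
  the robber.
\<close>

type_synonym 'v guard = "'v list \<times> ('v \<Rightarrow> nat)"

context subdivision
begin

text \<open>At the last index \<open>k * (length w - 1)\<close> the second list access is out of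
  range, but the offset is 0 and \<open>point\<close> ignores its far end.\<close>

definition walk_point :: "'a list \<Rightarrow> nat \<Rightarrow> 'a subdiv_vertex" where
  "walk_point w n = point (w ! (n div k)) (w ! Suc (n div k)) (n mod k)"

text \<open>Linear interpolation, provided that the labels of the two ends differ by at most
  one.\<close>

definition label :: "('a \<Rightarrow> nat) \<Rightarrow> 'a subdiv_vertex \<Rightarrow> nat" where
  "label l x = (case x of Branch u \<Rightarrow> k * l u
    | Inner u v i \<Rightarrow> if l u = l v then k * l u else if l u < l v then k * l u + i else k * l u - i)"

definition shadow :: "'a guard \<Rightarrow> 'a subdiv_vertex \<Rightarrow> 'a subdiv_vertex" where
  "shadow = (\<lambda>(w, l). walk_point w \<circ> label l)"

text \<open>The open star of \<open>S\<close>: it can be left only by stepping onto a branch vertex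
  outside \<open>S\<close>.\<close>

definition territory :: "'a set \<Rightarrow> 'a subdiv_vertex set" where
  "territory S = {point u v i | u v i. u \<in> S \<and> (u, v) \<in> parcs G \<and> i < k}"

text \<open>The labelling is constrained only on edges meeting \<open>S\<close>, where the robber is
  confined; this is what admits walks with a shortcut outside the region.\<close>

definition guard_on :: "'a set \<Rightarrow> 'a guard \<Rightarrow> bool" where
  "guard_on S = (\<lambda>(w, l). w \<noteq> [] \<and> set w \<subseteq> pverts G \<and> successively (\<lambda>u v. (u, v) \<in> parcs G) w \<and>
    (\<forall>u\<in>pverts G. l u < length w) \<and>
    (\<forall>(u, v)\<in>parcs G. u \<in> S \<longrightarrow> l u \<le> Suc (l v) \<and> l v \<le> Suc (l u)))"

definition fixes_vertex :: "'a guard \<Rightarrow> 'a \<Rightarrow> bool" where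
  "fixes_vertex = (\<lambda>(w, l) u. w ! l u = u)"

lemma shadow_Branch: "fixes_vertex g u \<Longrightarrow> shadow g (Branch u) = Branch u"
  using k_pos by (cases g) (simp add: fixes_vertex_def shadow_def label_def walk_point_def)

lemma walk_point_add:
  assumes "i \<le> k"
  shows "walk_point w (k * q + i) = point (w ! q) (w ! Suc q) i"
proof (cases "i = k")
  case True
  then have "k * q + i = k * Suc q" by simp
  then show ?thesis using True k_pos by (simp add: walk_point_def del: mult_Suc_right)
next
  case False
  then show ?thesis using assms by (simp add: walk_point_def)
qed

lemma walk_point_step:
  assumes "successively (\<lambda>u v. (u, v) \<in> parcs G) w" "n < k * (length w - 1)"
  shows "stays_or_moves H (walk_point w n) (walk_point w (Suc n))"
proof -
  define q where "q = n div k"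
  define i where "i = n mod k"
  have n: "n = k * q + i" "i < k" using k_pos by (auto simp: q_def i_def)
  have "q < length w - 1" using assms(2) k_pos by (simp add: q_def less_mult_imp_div_less mult.commute)
  then have "(w ! q, w ! Suc q) \<in> parcs G"
    using assms(1) by (simp add: successively_conv_nth)
  moreover have "walk_point w (Suc n) = point (w ! q) (w ! Suc q) (Suc i)"
    using walk_point_add[of "Suc i" w q] n by simp
  ultimately show ?thesis
    using walk_point_add[of i w q] n arc_point by (simp add: stays_or_moves_def)
qed

lemma label_point:
  assumes "(u, v) \<in> parcs G" "i \<le> k" "l u \<le> Suc (l v)" "l v \<le> Suc (l u)"
  shows "label l (point u v i) =
    (if l u = l v then k * l u else if l u < l v then k * l u + i else k * l u - i)"
proof -
  have "l u < l v \<Longrightarrow> l v = Suc (l u)" "l v < l u \<Longrightarrow> l u = Suc (l v)" using assms by auto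
  then show ?thesis
    using assms(2) arc_neq[OF assms(1)] by (fastforce simp: label_def subdiv_point_def)
qed

text \<open>A branch vertex \<open>x\<close> can be named from any of its edges; choosing the edge
  along the move puts \<open>x\<close> and \<open>y\<close> on a common one.\<close>

lemma move_territory:
  assumes "x \<in> territory S" "stays_or_moves H x y"
  obtains u v i j where "u \<in> S" "(u, v) \<in> parcs G" "i < k" "j \<le> k" "i \<le> Suc j" "j \<le> Suc i"
    "x = point u v i" "y = point u v j"
proof -
  from assms(1) obtain u v i where x: "u \<in> S" "(u, v) \<in> parcs G" "i < k" "x = point u v i"
    by (auto simp: territory_def)
  from x(2,3) assms(2)[unfolded x(4)] show ?thesis
  proof (cases rule: move_point)
    case stay
    with x that[of u v i i] show ?thesis by simp
  next
    case (forward v')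
    with x that[of u v' i "Suc i"] show ?thesis by auto
  next
    case backward
    with x that[of u v i "i - 1"] show ?thesis by simp
  qed
qed

text \<open>Along an edge meeting \<open>S\<close> the label is affine with slope 0, 1 or
  -1.\<close>

lemma label_lipschitz:
  assumes "guard_on S (w, l)" "x \<in> territory S" "stays_or_moves H x y"
  shows "label l x \<le> Suc (label l y)" "label l y \<le> Suc (label l x)"
    "label l x \<le> k * (length w - 1)" "label l y \<le> k * (length w - 1)"
proof -
  obtain u v i j where x: "u \<in> S" "(u, v) \<in> parcs G" "i < k" "j \<le> k" "i \<le> Suc j" "j \<le> Suc i"
    "x = point u v i" "y = point u v j" by (rule move_territory[OF assms(2,3)])
  have l: "l u \<le> Suc (l v)" "l v \<le> Suc (l u)" "l u < length w" "l v < length w"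
    using assms(1) x in_arcsD1 in_arcsD2 unfolding guard_on_def by auto
  note eq = label_point[where l = l, OF x(2) _ l(1,2)]
  define M where "M = k * (length w - 1)"
  have "k * l u \<le> M" "k * l v \<le> M" using l by (auto simp: M_def)
  moreover have "l u < l v \<Longrightarrow> k * l v = k * l u + k" "l v < l u \<Longrightarrow> k * l u = k * l v + k"
    using l by (metis le_SucE mult_Suc_right add.commute not_le)+
  ultimately show "label l x \<le> Suc (label l y)" "label l y \<le> Suc (label l x)"
    "label l x \<le> k * (length w - 1)" "label l y \<le> k * (length w - 1)"
    using x(3-6) unfolding x(7,8) M_def[symmetric] by (auto simp: eq)
qed

lemma shadow_moves:
  assumes "guard_on S g" "x \<in> territory S" "stays_or_moves H x y"
  shows "stays_or_moves H (shadow g x) (shadow g y)"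
proof -
  obtain w l where g: "g = (w, l)" by (cases g)
  note lip = label_lipschitz[OF assms(1)[unfolded g] assms(2,3)]
  have "stays_or_moves H (walk_point w n) (walk_point w (Suc n))" if "n < k * (length w - 1)" for n
    using that assms(1) by (intro walk_point_step) (auto simp: g guard_on_def)
  note step = this
  from lip consider "label l x = label l y" | "label l y = Suc (label l x)"
    | "label l x = Suc (label l y)" by linarith
  then show ?thesis
    using lip(3,4) step[of "label l x"] step[of "label l y"] H.stays_or_moves_sym
    by cases (auto simp: g shadow_def)
qed

lemma Branch_in_territory:
  assumes "u \<in> S" "(u, v) \<in> parcs G"
  shows "Branch u \<in> territory S"
  using assms k_pos by (force simp: territory_def)

lemma confines_territory:
  assumes "\<And>i. i \<in> I \<Longrightarrow> guard_on S (gs i)"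
    and "\<And>u v. (u, v) \<in> parcs G \<Longrightarrow> u \<in> S \<Longrightarrow> v \<notin> S \<Longrightarrow> \<exists>i\<in>I. fixes_vertex (gs i) v"
  shows "confines H (territory S) I (\<lambda>i. shadow (gs i))"
  unfolding confines_def
proof (intro ballI allI impI conjI)
  fix x y assume xy: "x \<in> territory S" "stays_or_moves H x y"
  show "stays_or_moves H (shadow (gs i) x) (shadow (gs i) y)" if "i \<in> I" for i
    using shadow_moves[OF assms(1)[OF that] xy] .
  obtain u v i j where y: "u \<in> S" "(u, v) \<in> parcs G" "i < k" "j \<le> k" "i \<le> Suc j" "j \<le> Suc i"
    "x = point u v i" "y = point u v j" by (rule move_territory[OF xy])
  show "y \<in> territory S \<or> (\<exists>i\<in>I. shadow (gs i) y = y)"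
  proof (cases "j = k")
    case True
    show ?thesis
    proof (cases "v \<in> S")
      case True
      then have "Branch v \<in> territory S" using Branch_in_territory[of v S u] y(2) arc_sym by blast
      with y \<open>j = k\<close> show ?thesis by simp
    next
      case False
      with y \<open>j = k\<close> assms(2)[of u v] show ?thesis by (auto intro: shadow_Branch)
    qed
  next
    case False
    with y show ?thesis unfolding territory_def by force
  qed
qed

lemma point_reaches: "(u, v) \<in> parcs G \<Longrightarrow> i \<le> k \<Longrightarrow> (point u v i, Branch u) \<in> (parcs H)\<^sup>*"
proof (induction i)
  case (Suc i)
  then have "(point u v (Suc i), point u v i) \<in> parcs H"
    using arc_point[of u v i] H.arcs_symmetric by simp
  with Suc show ?case by (auto intro: converse_rtrancl_into_rtrancl)
qed simp

lemma reaches_Branch: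
  assumes "pverts G \<times> pverts G \<subseteq> (parcs G)\<^sup>*"
    and "x \<in> pverts H" "v \<in> pverts G"
  shows "(x, Branch v) \<in> (parcs H)\<^sup>*"
proof -
  have branch: "(Branch u, Branch v) \<in> (parcs H)\<^sup>*" if "(u, v) \<in> (parcs G)\<^sup>*" for u
    using that
  proof (induction rule: converse_rtrancl_induct)
    case (step y z)
    then have "(point z y k, Branch z) \<in> (parcs H)\<^sup>*" using arc_sym by (intro point_reaches) auto
    with step show ?case by simp
  qed simp
  from assms(2) consider u where "u \<in> pverts G" "x = Branch u"
    | u w i where "(u, w) \<in> parcs G" "i \<le> k" "x = point u w i"
    by (auto simp: subdivide_edges_def)
  then obtain u where "u \<in> pverts G" "(x, Branch u) \<in> (parcs H)\<^sup>*"
    by cases (use point_reaches in_arcsD1 in blast)+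
  with branch[of u] assms(1,3) show ?thesis by (auto intro: rtrancl_trans)
qed

lemma secures_acquire_guard:
  assumes conn: "pverts G \<times> pverts G \<subseteq> (parcs G)\<^sup>*"
    and "confines H T I f" "I \<subseteq> {..<m}" "j < m" "j \<notin> I" "T \<subseteq> territory S" "guard_on S g"
    and "secures H m T (insert j I) (f(j := shadow g))"
  shows "secures H m T I f"
proof -
  obtain w l where g: "g = (w, l)" by (cases g)
  let ?M = "k * (length w - 1)"
  have w: "w \<noteq> []" "set w \<subseteq> pverts G" "successively (\<lambda>u v. (u, v) \<in> parcs G) w"
    using assms(7) by (auto simp: g guard_on_def)
  show ?thesis
  proof (rule H.secures_acquire[OF assms(2-5), of "label l" ?M "walk_point w"])
    show "label l x \<le> Suc (label l y)" if "x \<in> T" "stays_or_moves H x y" for x y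
      using label_lipschitz[OF assms(7)[unfolded g]] assms(6) that by blast
    show "label l x \<le> ?M" if "x \<in> T" for x
      using label_lipschitz(3)[OF assms(7)[unfolded g], of x x] assms(6) that by auto
    show "stays_or_moves H (walk_point w n) (walk_point w (Suc n))" if "n < ?M" for n
      using walk_point_step w that by blast
    show "(x, walk_point w 0) \<in> (parcs H)\<^sup>*" if "x \<in> pverts H" for x
    proof -
      have "w ! 0 \<in> pverts G" using w nth_mem[of 0 w] by auto
      with reaches_Branch[OF conn that] show ?thesis by (simp add: walk_point_def)
    qed
    show "secures H m T (insert j I) (f(j := walk_point w \<circ> label l))"
      using assms(8) by (simp add: g shadow_def)
  qed
qed

text \<open>A third cop sweeps an open edge whose ends are guarded by two others.\<close>

lemma secures_edge:
  assumes conn: "pverts G \<times> pverts G \<subseteq> (parcs G)\<^sup>*"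
    and "2 < m" "a < m" "b < m" "(u, v) \<in> parcs G" "f a (Branch u) = Branch u" "f b (Branch v) = Branch v"
    and moves: "\<And>x y i. x \<in> T \<Longrightarrow> stays_or_moves H x y \<Longrightarrow> i \<in> {a, b} \<Longrightarrow> stays_or_moves H (f i x) (f i y)"
    and T: "T = {point u v i | i. 0 < i \<and> i < k}"
  shows "secures H m T {a, b} f"
proof -
  have "card {a, b} < card {..<m}" using assms(2) by (simp add: card_insert_if)
  then have "\<not> {..<m} \<subseteq> {a, b}" using card_mono[of "{a, b}" "{..<m}"] by auto
  then obtain c where c: "c < m" "c \<notin> {a, b}" by auto
  \<comment> \<open>This labelling makes the walk \<open>[u, v]\<close> copy the edge point by
    point, so the cop who reaches his shadow has caught the robber.\<close>
  define l where "l x = (if x = v then 1 else 0 :: nat)" for x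
  let ?g = "([u, v], l)"
  have uv: "u \<noteq> v" "u \<in> pverts G" "v \<in> pverts G" using assms(5) arc_neq in_arcsD1 in_arcsD2 by auto
  have conf: "confines H T {a, b} f"
    unfolding confines_def
  proof (intro ballI allI impI conjI)
    fix x y assume xy: "x \<in> T" "stays_or_moves H x y"
    then show "stays_or_moves H (f i x) (f i y)" if "i \<in> {a, b}" for i using moves that by blast
    from xy(1) obtain i where i: "0 < i" "i < k" "x = point u v i" using T by blast
    from assms(5) i(2) xy(2)[unfolded i(3)] have "\<exists>j\<le>k. y = point u v j"
    proof (cases rule: move_point)
      case stay
      with i show ?thesis by (intro exI[of _ i]) simp
    next
      case (forward v')
      with i show ?thesis by (intro exI[of _ "Suc i"]) simp
    next
      case backward
      with i show ?thesis by (intro exI[of _ "i - 1"]) simp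
    qed
    then obtain j where j: "j \<le> k" "y = point u v j" by blast
    consider "j = 0" | "j = k" | "0 < j" "j < k" using j by linarith
    then show "y \<in> T \<or> (\<exists>i\<in>{a, b}. f i y = y)"
      by cases (use j T assms(6,7) in auto)
  qed
  have guard: "guard_on {u} ?g"
    using assms(5) uv by (auto simp: guard_on_def l_def)
  have T_sub: "T \<subseteq> territory {u}" using T assms(5) by (auto simp: territory_def)
  have fix_T: "shadow ?g x = x" if x: "x \<in> T" for x
  proof -
    from x obtain i where i: "0 < i" "i < k" "x = point u v i" using T by blast
    have "label l x = i" unfolding i(3) using label_point[OF assms(5), of i l] i uv by (simp add: l_def)
    then show ?thesis using i by (simp add: shadow_def walk_point_def)
  qed
  have "secures H m T (insert c {a, b}) (f(c := shadow ?g))"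
    using c assms(3,4) fix_T by (intro secures_cover) auto
  then show ?thesis
    using assms(3,4) by (intro secures_acquire_guard[OF conn conf _ c T_sub guard]) auto
qed

text \<open>Once cop \<open>j\<close> follows \<open>g\<close>, every branch vertex in reach but
  outside \<open>S'\<close> is fixed by a guard. The robber then stands on such a vertex and is
  caught, or is in \<open>territory S'\<close>, or is inside an edge with both ends fixed, where
  \<open>secures_edge\<close> applies. \<open>J\<close> are the guards kept for
  \<open>S'\<close>.\<close>

theorem secures_territory:
  assumes conn: "pverts G \<times> pverts G \<subseteq> (parcs G)\<^sup>*"
    and I: "2 < m" "I \<subseteq> {..<m}" "j < m" "j \<notin> I"
    and guards: "\<And>i. i \<in> I \<Longrightarrow> guard_on S (gs i)" "guard_on S g"
    and boundary: "\<And>u v. (u, v) \<in> parcs G \<Longrightarrow> u \<in> S \<Longrightarrow> v \<notin> S \<Longrightarrow> \<exists>i\<in>I. fixes_vertex (gs i) v"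
    and cut: "\<And>u. u \<in> S \<Longrightarrow> u \<notin> S' \<Longrightarrow> \<exists>i\<in>insert j I. fixes_vertex ((gs(j := g)) i) u"
    and J: "J \<subseteq> insert j I"
    and next_secures: "secures H m (territory S') J (\<lambda>i. shadow ((gs(j := g)) i))"
  shows "secures H m (territory S) I (\<lambda>i. shadow (gs i))"
proof -
  let ?gs = "gs(j := g)"
  let ?f = "\<lambda>i. shadow (?gs i)"
  have f: "(\<lambda>i. shadow (gs i))(j := shadow g) = ?f" by auto
  note conf = confines_territory[of I S gs, OF guards(1) boundary]
  have fixed: "\<exists>i\<in>insert j I. ?f i (Branch u) = Branch u"
    if "u \<notin> S'" "u \<in> S \<or> (\<exists>v. (v, u) \<in> parcs G \<and> v \<in> S)" for u
  proof (cases "u \<in> S")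
    case True
    with cut that show ?thesis by (meson shadow_Branch)
  next
    case False
    with that boundary obtain i where "i \<in> I" "fixes_vertex (gs i) u" by blast
    with I show ?thesis by (auto intro!: bexI[of _ i] shadow_Branch)
  qed
  have "secures H m (territory S) (insert j I) ?f"
  proof (rule secures_cover)
    fix r assume r: "r \<in> territory S"
    then obtain u v i where uvi: "u \<in> S" "(u, v) \<in> parcs G" "i < k" "r = point u v i"
      by (auto simp: territory_def)
    show "(\<exists>i\<in>insert j I. ?f i r = r) \<or> (\<exists>T J. r \<in> T \<and> J \<subseteq> insert j I \<and> secures H m T J ?f)"
    proof (cases "r \<in> territory S'")
      case True
      with J next_secures show ?thesis by blast
    next
      case False
      then have u: "u \<notin> S'" using uvi by (auto simp: territory_def)
      with fixed uvi obtain a where a: "a \<in> insert j I" "?f a (Branch u) = Branch u" by blast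
      show ?thesis
      proof (cases "i = 0")
        case True
        with a uvi show ?thesis by (intro disjI1 bexI[of _ a]) auto
      next
        case i: False
        \<comment> \<open>Seen from an end \<open>v\<close> in \<open>S'\<close>, the robber would
          be in \<open>territory S'\<close>.\<close>
        have "v \<notin> S'"
        proof
          assume "v \<in> S'"
          then have "point v u (k - i) \<in> territory S'"
            using uvi i arc_sym unfolding territory_def by force
          with False uvi show False by (simp add: point_swap)
        qed
        with fixed uvi obtain b where b: "b \<in> insert j I" "?f b (Branch v) = Branch v" by blast
        let ?T = "{point u v i | i. 0 < i \<and> i < k}"
        have T_sub: "?T \<subseteq> territory S" using uvi by (auto simp: territory_def)
        have guard: "guard_on S (?gs i)" if "i \<in> insert j I" for i
          using guards that by auto
        have "secures H m ?T {a, b} ?f"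
        proof (rule secures_edge[OF conn I(1) _ _ uvi(2) a(2) b(2) _ refl])
          show "a < m" "b < m" using a(1) b(1) I by auto
          show "stays_or_moves H (?f i x) (?f i y)"
            if "x \<in> ?T" "stays_or_moves H x y" "i \<in> {a, b}" for x y i
          proof (rule shadow_moves[OF guard])
            show "i \<in> insert j I" using that(3) a(1) b(1) by blast
          qed (use that T_sub in blast)+
        qed
        moreover have "r \<in> ?T" using uvi i by auto
        moreover have "{a, b} \<subseteq> insert j I" using a(1) b(1) by blast
        ultimately show ?thesis by (intro disjI2 exI[of _ ?T] exI[of _ "{a, b}"] conjI)
      qed
    qed
  qed (use I in auto)
  then show ?thesis
    using secures_acquire_guard[OF conn conf I(2-4) order_refl guards(2)] f by simp
qed

text \<open>With no guards in force any placement is \<open>shadowed\<close>, so all cops may start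
  at one vertex.\<close>

lemma cops_win_if_secures:
  assumes "u \<in> pverts G" "\<And>u. u \<in> pverts G \<Longrightarrow> \<exists>v. (u, v) \<in> parcs G"
    and "secures H m (territory (pverts G)) {} f"
  shows "cops_win H m"
proof (rule cops_winI)
  show sub: "set (replicate m (Branch u)) \<subseteq> pverts H" using assms(1) Branch_in_verts_iff by auto
  fix r assume "r \<in> pverts H"
  then consider v where "v \<in> pverts G" "r = Branch v"
    | v w i where "(v, w) \<in> parcs G" "v < w" "i < k" "0 < i" "r = Inner v w i" by (auto simp: pverts_H)
  then have "r \<in> territory (pverts G)"
  proof cases
    case 1
    with assms(2) Branch_in_territory show ?thesis by blast
  next
    case 2
    then have "r = point v w i" by (simp add: subdiv_point_def)
    with 2 in_arcsD1 show ?thesis unfolding territory_def by blast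
  qed
  then show "wins H (replicate m (Branch u)) r"
    using assms(3)[unfolded secures_def, rule_format, of "replicate m (Branch u)" r] sub
    by (simp add: shadowed_def)
qed simp

end

section \<open>The cop number of the subdivided dodecahedron graph\<close>

interpretation dodecahedron: subdivision dodecahedron_graph 15
  by (intro subdivision.intro pair_graph_dodecahedron_graph subdivision_axioms.intro) simp

lemma pverts_dodecahedron_graph: "pverts dodecahedron_graph = {..<20}"
  by (simp add: dodecahedron_graph_def Let_def)

section \<open>Finite facts about the dodecahedron graph and the lower bound\<close>

definition dodecahedron_nbrs :: "nat list list" where
  "dodecahedron_nbrs =
    [[1, 9, 10], [0, 2, 11], [1, 3, 12], [2, 4, 13], [3, 5, 14], [4, 6, 15], [5, 7, 16], [6, 8,
    17], [7, 9, 18], [0, 8, 19], [0, 12, 18], [1, 13, 19], [2, 10, 14], [3, 11, 15], [4, 12, 16],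
    [5, 13, 17], [6, 14, 18], [7, 15, 19], [8, 10, 16], [9, 11, 17]]"

lemma dodecahedron_arcs_nbrs:
  "set dodecahedron_arcs = set (concat (map (\<lambda>u. map (Pair u) (dodecahedron_nbrs ! u)) [0..<20]))"
  by code_simp

lemma parcs_dodecahedron_nbrs:
  "(u, v) \<in> parcs dodecahedron_graph \<longleftrightarrow> u \<in> set [0..<20] \<and> v \<in> set (dodecahedron_nbrs ! u)"
  unfolding parcs_dodecahedron_graph dodecahedron_arcs_nbrs by auto

text \<open>Besides degree three and the absence of triangles and four-cycles, every vertex but 0
  has a smaller neighbour; descending along these yields connectedness.\<close>

lemma dodecahedron_nbrs_properties:
  "\<forall>u\<in>set [0..<20]. length (remdups (dodecahedron_nbrs ! u)) = 3 \<and>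
    (u = 0 \<or> (\<exists>v\<in>set (dodecahedron_nbrs ! u). v < u)) \<and>
    (\<forall>v\<in>set (dodecahedron_nbrs ! u). \<forall>w\<in>set (dodecahedron_nbrs ! u).
      w \<notin> set (dodecahedron_nbrs ! v) \<and>
      (v \<noteq> w \<longrightarrow> (\<forall>u'\<in>set (dodecahedron_nbrs ! v). u' \<in> set (dodecahedron_nbrs ! w) \<longrightarrow> u' = u)))"
  by code_simp

lemma not_cops_win_dodecahedron:
  assumes "m < 3"
  shows "\<not> cops_win dodecahedron.H m"
proof (rule dodecahedron.not_cops_win)
  let ?G = dodecahedron_graph
  note props = bspec[OF dodecahedron_nbrs_properties]
  show "m < card {v. (u, v) \<in> parcs ?G}" if "u \<in> pverts ?G" for u
  proof -
    have u: "u \<in> set [0..<20]" using that by (simp add: pverts_dodecahedron_graph)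
    then have "{v. (u, v) \<in> parcs ?G} = set (dodecahedron_nbrs ! u)"
      by (auto simp: parcs_dodecahedron_nbrs)
    then show ?thesis using props[OF u] assms by (simp add: length_remdups_card_conv)
  qed
  show "(v, w) \<notin> parcs ?G" if "(u, v) \<in> parcs ?G" "(u, w) \<in> parcs ?G" for u v w
    using props[of u] that by (simp add: parcs_dodecahedron_nbrs)
  show "u = u'" if "(u, v) \<in> parcs ?G" "(u, w) \<in> parcs ?G" "(u', v) \<in> parcs ?G" "(u', w) \<in> parcs ?G"
    "v \<noteq> w" for u u' v w
  proof -
    have "u' \<in> set (dodecahedron_nbrs ! v)" "u' \<in> set (dodecahedron_nbrs ! w)"
      using that dodecahedron.arc_sym parcs_dodecahedron_nbrs by blast+
    then show ?thesis using props[of u] that unfolding parcs_dodecahedron_nbrs by blast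
  qed
qed (simp_all add: pverts_dodecahedron_graph lessThan_empty_iff)

lemma dodecahedron_graph_connected:
  "pverts dodecahedron_graph \<times> pverts dodecahedron_graph \<subseteq> (parcs dodecahedron_graph)\<^sup>*"
proof -
  have zero: "(u, 0) \<in> (parcs dodecahedron_graph)\<^sup>*" if "u < 20" for u
    using that
  proof (induction u rule: less_induct)
    case (less u)
    show ?case
    proof (cases "u = 0")
      case False
      have "u \<in> set [0..<20]" using less.prems by simp
      with bspec[OF dodecahedron_nbrs_properties] False
      have "\<exists>v\<in>set (dodecahedron_nbrs ! u). v < u" by blast
      then obtain v where "v \<in> set (dodecahedron_nbrs ! u)" "v < u" by blast
      moreover from this have "(u, v) \<in> parcs dodecahedron_graph"
        using less.prems by (simp add: parcs_dodecahedron_nbrs)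
      ultimately show ?thesis
        using less by (auto intro: converse_rtrancl_into_rtrancl)
    qed simp
  qed
  have "sym (parcs dodecahedron_graph)"
    using dodecahedron.arc_sym by (auto intro: symI)
  then have "(0, u) \<in> (parcs dodecahedron_graph)\<^sup>*" if "u < 20" for u
    using zero[OF that] sym_rtrancl by (meson symD)
  with zero show ?thesis by (auto simp: pverts_dodecahedron_graph intro: rtrancl_trans)
qed

section \<open>Guards given by lists, with conditions decided by evaluation\<close>

type_synonym list_guard = "nat list \<times> nat list"

definition to_guard :: "list_guard \<Rightarrow> nat guard" where
  "to_guard = (\<lambda>(w, ls). (w, (!) ls))"

definition guard_check :: "nat list \<Rightarrow> list_guard \<Rightarrow> bool" where
  "guard_check S = (\<lambda>(w, ls). w \<noteq> [] \<and> list_all (\<lambda>u. u < 20) w \<and>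
    successively (\<lambda>u v. v \<in> set (dodecahedron_nbrs ! u)) w \<and>
    list_all (\<lambda>u. ls ! u < length w) [0..<20] \<and>
    list_all (\<lambda>u. list_all (\<lambda>v. ls ! u \<le> Suc (ls ! v) \<and> ls ! v \<le> Suc (ls ! u))
      (dodecahedron_nbrs ! u)) S)"

definition fix_check :: "list_guard \<Rightarrow> nat \<Rightarrow> bool" where
  "fix_check = (\<lambda>(w, ls) u. w ! (ls ! u) = u)"

text \<open>\<open>held\<close> are the guards in force and \<open>g\<close> is the new one. The
  last two conditions are \<open>boundary\<close> and \<open>cut\<close> of
  \<open>secures_territory\<close>.\<close>

definition stage_check :: "nat list \<Rightarrow> nat list \<Rightarrow> list_guard list \<Rightarrow> list_guard \<Rightarrow> bool" where
  "stage_check S S' held g \<longleftrightarrow>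
    list_all (\<lambda>u. u < 20) S \<and> list_all (guard_check S) (g # held) \<and>
    list_all (\<lambda>u. list_all (\<lambda>v. v \<in> set S \<or> list_ex (\<lambda>h. fix_check h v) held)
      (dodecahedron_nbrs ! u)) S \<and>
    list_all (\<lambda>u. u \<in> set S' \<or> list_ex (\<lambda>h. fix_check h u) (g # held)) S"

lemma guard_on_to_guard:
  assumes "guard_check S g"
  shows "dodecahedron.guard_on (set S) (to_guard g)"
proof -
  obtain w ls where g: "g = (w, ls)" by (cases g)
  have "successively (\<lambda>u v. (u, v) \<in> parcs dodecahedron_graph) w"
  proof (rule successively_mono)
    show "successively (\<lambda>u v. v \<in> set (dodecahedron_nbrs ! u)) w"
      using assms by (simp add: g guard_check_def)
    show "(u, v) \<in> parcs dodecahedron_graph" if "u \<in> set w" "v \<in> set w" "v \<in> set (dodecahedron_nbrs ! u)"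
      for u v using assms that by (auto simp: g guard_check_def parcs_dodecahedron_nbrs list_all_iff)
  qed
  then show ?thesis
    using assms unfolding dodecahedron.guard_on_def
    by (auto simp: g to_guard_def guard_check_def parcs_dodecahedron_nbrs list_all_iff
        pverts_dodecahedron_graph)
qed

lemma fixes_vertex_to_guard: "dodecahedron.fixes_vertex (to_guard g) u \<longleftrightarrow> fix_check g u"
  by (cases g) (simp add: dodecahedron.fixes_vertex_def to_guard_def fix_check_def)

lemma secures_stage:
  assumes check: "stage_check S S' held g"
    and I: "I \<subseteq> {..<3}" "j < 3" "j \<notin> I" and held: "gs ` I = to_guard ` set held"
    and J: "J \<subseteq> insert j I"
    and next_secures: "secures dodecahedron.H 3 (dodecahedron.territory (set S')) J
      (\<lambda>i. dodecahedron.shadow ((gs(j := to_guard g)) i))"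
  shows "secures dodecahedron.H 3 (dodecahedron.territory (set S)) I
    (\<lambda>i. dodecahedron.shadow (gs i))"
proof (rule dodecahedron.secures_territory[OF dodecahedron_graph_connected _ I _ _ _ _ J next_secures])
  have held_index: "\<exists>i\<in>I. gs i = to_guard h" if "h \<in> set held" for h
  proof -
    have "to_guard h \<in> gs ` I" using that unfolding held by blast
    then show ?thesis by (metis imageE)
  qed
  show "dodecahedron.guard_on (set S) (gs i)" if "i \<in> I" for i
  proof -
    have "gs i \<in> to_guard ` set held" using that unfolding held[symmetric] by blast
    then obtain h where "h \<in> set held" "gs i = to_guard h" by blast
    with check show ?thesis by (simp add: stage_check_def list_all_iff guard_on_to_guard)
  qed
  show "dodecahedron.guard_on (set S) (to_guard g)"
    using check by (simp add: stage_check_def guard_on_to_guard)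
  show "\<exists>i\<in>I. dodecahedron.fixes_vertex (gs i) v"
    if uv: "(u, v) \<in> parcs dodecahedron_graph" "u \<in> set S" "v \<notin> set S" for u v
  proof -
    have "v \<in> set S \<or> (\<exists>h\<in>set held. fix_check h v)"
      using check uv(1,2)
      unfolding stage_check_def list_all_iff list_ex_iff parcs_dodecahedron_nbrs by blast
    with uv(3) obtain h where "h \<in> set held" "fix_check h v" by blast
    with held_index show ?thesis by (metis fixes_vertex_to_guard)
  qed
  show "\<exists>i\<in>insert j I. dodecahedron.fixes_vertex ((gs(j := to_guard g)) i) u"
    if u: "u \<in> set S" "u \<notin> set S'" for u
  proof -
    have "u \<in> set S' \<or> (\<exists>h\<in>set (g # held). fix_check h u)"
      using check u(1) unfolding stage_check_def list_all_iff list_ex_iff by blast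
    with u(2) obtain h where h: "h \<in> set (g # held)" "fix_check h u" by blast
    show ?thesis
    proof (cases "h = g")
      case True
      with h show ?thesis by (simp add: fixes_vertex_to_guard)
    next
      case False
      with h(1) have "h \<in> set held" by simp
      from held_index[OF this] obtain i where i: "i \<in> I" "gs i = to_guard h" by blast
      moreover have "i \<noteq> j" using i I by blast
      ultimately show ?thesis
        using h by (intro bexI[of _ i]) (simp_all add: fixes_vertex_to_guard)
    qed
  qed
qed simp

text \<open>The walks and labellings were found by a computer search.\<close>

definition guard1 :: list_guard where
  "guard1 = ([11, 19, 17, 7, 6, 16], [2, 1, 2, 2, 3, 3, 4, 3, 3, 2, 3, 0, 3, 1, 4, 2, 5, 2, 4, 1])"

text \<open>The ends 7 and 17 are adjacent but have labels 0 and 8: the labelling is non-expansive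
  along the edges meeting \<open>territory2\<close>, not on the whole graph.\<close>

definition guard2 :: list_guard where
  "guard2 = ([7, 8, 9, 0, 1, 11, 13, 15, 17],
    [3, 4, 5, 6, 5, 6, 7, 0, 1, 2, 3, 5, 4, 6, 4, 7, 3, 8, 2, 3])"

text \<open>At vertices neither in \<open>territory3\<close> nor adjacent to it the label 0 is a
  filler.\<close>

definition guard3 :: list_guard where
  "guard3 = ([6, 5, 4, 14, 16, 18, 8], [6, 5, 4, 3, 2, 1, 0, 0, 6, 0, 5, 0, 4, 4, 3, 2, 4, 0, 5, 0])"

text \<open>The walk passes through all of \<open>territory4\<close>, so no branch vertex
  remains.\<close>

definition guard4 :: list_guard where
  "guard4 = ([0, 10, 12, 2, 3, 13], [0, 4, 3, 4, 5, 0, 0, 0, 0, 0, 1, 0, 2, 5, 3, 0, 0, 0, 2, 0])"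

text \<open>Each list is what the new walk leaves of the previous region. The neighbours of
  \<open>territory4\<close> outside it are fixed by \<open>guard2\<close> and \<open>guard3\<close>
  alone, which releases the cop on \<open>guard1\<close>.\<close>

abbreviation "territory2 \<equiv> [0, 1, 2, 3, 4, 5, 8, 9, 10, 12, 13, 14, 15, 18 :: nat]"
abbreviation "territory3 \<equiv> [2, 3, 4, 5, 10, 12, 14, 18 :: nat]"
abbreviation "territory4 \<equiv> [2, 3, 10, 12 :: nat]"

lemma stage_checks:
  "stage_check [0..<20] territory2 [] guard1"
  "stage_check territory2 territory3 [guard1] guard2"
  "stage_check territory3 territory4 [guard1, guard2] guard3"
  "stage_check territory4 [] [guard2, guard3] guard4"
  by code_simp+

lemma cops_win_dodecahedron: "cops_win dodecahedron.H 3"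
proof -
  let ?gs = "\<lambda>i. to_guard guard1"
  \<comment> \<open>The stages are composed backwards from the empty region. Cop 0 occurs twice: the
    update to \<open>guard4\<close> overwrites his released \<open>guard1\<close>.\<close>
  have "secures dodecahedron.H 3 (dodecahedron.territory (set [])) {}
      (\<lambda>i. dodecahedron.shadow ((?gs(0 := to_guard guard1, 1 := to_guard guard2,
        2 := to_guard guard3, 0 := to_guard guard4)) i))"
    by (simp add: secures_def dodecahedron.territory_def)
  then have "secures dodecahedron.H 3 (dodecahedron.territory (set territory4)) {1, 2}
      (\<lambda>i. dodecahedron.shadow ((?gs(0 := to_guard guard1, 1 := to_guard guard2,
        2 := to_guard guard3)) i))"
    by (rule secures_stage[OF stage_checks(4), rotated -1]) auto
  then have "secures dodecahedron.H 3 (dodecahedron.territory (set territory3)) {0, 1}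
      (\<lambda>i. dodecahedron.shadow ((?gs(0 := to_guard guard1, 1 := to_guard guard2)) i))"
    by (rule secures_stage[OF stage_checks(3), rotated -1]) auto
  then have "secures dodecahedron.H 3 (dodecahedron.territory (set territory2)) {0}
      (\<lambda>i. dodecahedron.shadow ((?gs(0 := to_guard guard1)) i))"
    by (rule secures_stage[OF stage_checks(2), rotated -1]) auto
  then have "secures dodecahedron.H 3 (dodecahedron.territory (set [0..<20])) {}
      (\<lambda>i. dodecahedron.shadow (?gs i))"
    by (rule secures_stage[OF stage_checks(1), rotated -1]) auto
  moreover have "set [0..<20] = pverts dodecahedron_graph"
    by (auto simp: pverts_dodecahedron_graph)
  ultimately have secures: "secures dodecahedron.H 3
      (dodecahedron.territory (pverts dodecahedron_graph)) {} (\<lambda>i. dodecahedron.shadow (?gs i))"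
    by simp
  show ?thesis
  proof (rule dodecahedron.cops_win_if_secures[OF _ _ secures])
    show "0 \<in> pverts dodecahedron_graph" by (simp add: pverts_dodecahedron_graph)
    show "\<exists>v. (u, v) \<in> parcs dodecahedron_graph" if "u \<in> pverts dodecahedron_graph" for u
    proof -
      have u: "u \<in> set [0..<20]" using that by (simp add: pverts_dodecahedron_graph)
      with bspec[OF dodecahedron_nbrs_properties] have "length (remdups (dodecahedron_nbrs ! u)) = 3"
        by blast
      then obtain v where "v \<in> set (dodecahedron_nbrs ! u)"
        by (cases "dodecahedron_nbrs ! u") auto
      with u show ?thesis using parcs_dodecahedron_nbrs by blast
    qed
  qed
qed

theorem cop_number_dodecahedron: "cop_number dodecahedron.H = 3"
  unfolding cop_number_def
  using cops_win_dodecahedron not_cops_win_dodecahedron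
  by (intro Least_equality) (auto simp: not_less[symmetric])

section \<open>The geometric representation\<close>

text \<open>Adjacency read off from the names alone, without consulting the arcs of the graph, so
  that it evaluates quickly.\<close>

fun subdiv_adjacent :: "nat \<Rightarrow> 'a subdiv_vertex \<Rightarrow> 'a subdiv_vertex \<Rightarrow> bool" where
  "subdiv_adjacent k (Branch _) (Branch _) \<longleftrightarrow> False"
| "subdiv_adjacent k (Branch w) (Inner u v i) \<longleftrightarrow> w = u \<and> i = 1 \<or> w = v \<and> Suc i = k"
| "subdiv_adjacent k (Inner u v i) (Branch w) \<longleftrightarrow> w = u \<and> i = 1 \<or> w = v \<and> Suc i = k"
| "subdiv_adjacent k (Inner u v i) (Inner u' v' j) \<longleftrightarrow> u = u' \<and> v = v' \<and> (j = Suc i \<or> i = Suc j)"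

context subdivision
begin

lemma subdiv_adjacent_arc:
  assumes "x \<in> pverts H" "y \<in> pverts H" "subdiv_adjacent k x y"
  shows "(x, y) \<in> parcs H"
proof -
  have inner: "(u, v) \<in> parcs G \<and> Inner u v i = point u v i \<and> 0 < i \<and> i < k"
    if "Inner u v i \<in> pverts H" for u v i
    using that by (auto simp: pverts_H subdiv_point_def)
  have arc: "(point u v i, point u v j) \<in> parcs H"
    if "(u, v) \<in> parcs G" "i < k \<and> j = Suc i \<or> j < k \<and> i = Suc j" for u v i j
    using that arc_point H.arcs_symmetric by blast
  show ?thesis
  proof (cases x)
    case x: (Branch w)
    then obtain u v i where y: "y = Inner u v i" "w = u \<and> i = 1 \<or> w = v \<and> Suc i = k"
      using assms(3) by (cases y) auto
    with inner assms(2) have i: "(u, v) \<in> parcs G" "y = point u v i" "0 < i" "i < k" by auto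
    from y(2) show ?thesis
    proof (elim disjE conjE)
      assume "w = u" "i = 1"
      then show ?thesis using arc[OF i(1), of 0 i] i by (simp add: x)
    next
      assume "w = v" "Suc i = k"
      then show ?thesis using arc[OF i(1), of k i] i by (simp add: x)
    qed
  next
    case x: (Inner u v i)
    with inner assms(1) have i: "(u, v) \<in> parcs G" "x = point u v i" "0 < i" "i < k" by auto
    show ?thesis
    proof (cases y)
      case (Branch w)
      then have "w = u \<and> i = 1 \<or> w = v \<and> Suc i = k" using assms(3) x by simp
      then show ?thesis
      proof (elim disjE conjE)
        assume "w = u" "i = 1"
        then show ?thesis using arc[OF i(1), of i 0] i by (simp add: Branch)
      next
        assume "w = v" "Suc i = k"
        then show ?thesis using arc[OF i(1), of i k] i by (simp add: Branch)
      qed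
    next
      case (Inner u' v' j)
      with inner assms(2) have j: "y = point u' v' j" "j < k" by auto
      have "u = u' \<and> v = v' \<and> (j = Suc i \<or> i = Suc j)" using assms(3) x Inner by simp
      then show ?thesis using arc[OF i(1), of i j] i j by auto
    qed
  qed
qed

end

text \<open>
  The positions were found by numerical relaxation in a shrinking disc and then rounded; adjacent
  vertices have distance at most \<open>56\<close>, and \<open>3136 = 56\<^sup>2\<close>.
\<close>

definition branch_positions :: "(int \<times> int) list" where
  "branch_positions =
    [(1244, 535), (996, 853), (789, 1125), (644, 1252), (348, 1034), (119, 802), (155, 427), (532,
    278), (788, 160), (885, 330), (821, 583), (1190, 1044), (914, 780), (454, 1281), (638, 893),
    (0, 657), (371, 714), (454, 32), (608, 500), (1188, 271)]"

definition edge_positions :: "((nat \<times> nat) \<times> (int \<times> int) list) list" where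
  "edge_positions =
    [((0, 1), [(1247, 573), (1219, 615), (1196, 617), (1172, 651), (1191, 680), (1228, 706),
     (1199, 750), (1179, 770), (1140, 753), (1106, 736), (1083, 782), (1051, 809), (1020, 796),
     (977, 818)]),
     ((0, 9), [(1233, 486), (1221, 443), (1215, 430), (1164, 449), (1168, 396), (1150, 372),
     (1110, 391), (1079, 375), (1057, 358), (1041, 333), (1008, 297), (967, 274), (937, 298),
     (921, 329)]),
     ((0, 10), [(1192, 542), (1144, 556), (1121, 526), (1086, 484), (1064, 459), (1038, 418),
     (1018, 401), (976, 407), (986, 453), (983, 490), (947, 521), (928, 542), (890, 549), (840,
     561)]),
     ((1, 2), [(985, 900), (966, 914), (996, 959), (994, 986), (967, 1023), (919, 1012), (924,
     976), (885, 952), (862, 953), (832, 977), (844, 1026), (817, 1037), (770, 1036), (762,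
     1077)]),
     ((1, 11), [(1040, 869), (1082, 893), (1099, 851), (1149, 831), (1167, 845), (1168, 892),
     (1187, 907), (1184, 955), (1153, 961), (1128, 946), (1093, 988), (1097, 1040), (1138, 1022),
     (1168, 1019)]),
     ((2, 3), [(838, 1125), (890, 1113), (915, 1105), (964, 1104), (993, 1149), (982, 1170), (945,
     1186), (900, 1171), (871, 1193), (826, 1224), (789, 1231), (764, 1247), (713, 1236), (696,
     1255)]),
     ((2, 12), [(750, 1137), (716, 1127), (694, 1078), (699, 1055), (687, 1010), (712, 962), (763,
     975), (770, 948), (771, 894), (771, 858), (803, 822), (841, 849), (872, 851), (912, 833)]),
     ((3, 4), [(642, 1209), (600, 1183), (621, 1155), (621, 1101), (612, 1062), (612, 1023), (618,
     994), (567, 984), (536, 1012), (507, 995), (469, 1016), (446, 1005), (419, 1051), (382,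
     1071)]),
     ((3, 13), [(595, 1251), (560, 1250), (535, 1232), (535, 1184), (507, 1154), (522, 1117),
     (491, 1084), (457, 1100), (436, 1114), (398, 1129), (382, 1153), (404, 1188), (435, 1217),
     (454, 1242)]),
     ((4, 5), [(312, 1053), (289, 1100), (271, 1094), (234, 1084), (208, 1048), (211, 1019), (234,
     996), (242, 944), (217, 936), (196, 903), (146, 921), (111, 913), (99, 864), (141, 839)]),
     ((4, 14), [(387, 998), (367, 974), (355, 945), (330, 926), (322, 880), (370, 875), (391,
     900), (421, 919), (447, 897), (479, 929), (499, 924), (552, 922), (576, 897), (609, 934)]),
     ((5, 6), [(145, 776), (188, 805), (221, 771), (213, 744), (236, 704), (227, 661), (261, 633),
     (245, 592), (236, 542), (264, 534), (275, 483), (247, 476), (202, 496), (169, 460)]),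
     ((5, 15), [(94, 803), (64, 765), (84, 739), (125, 711), (152, 686), (154, 645), (181, 603),
     (177, 587), (136, 564), (128, 545), (79, 567), (100, 615), (78, 656), (36, 667)]),
     ((6, 7), [(141, 377), (156, 345), (174, 298), (195, 274), (239, 303), (261, 307), (303, 320),
     (337, 289), (361, 321), (392, 351), (438, 335), (472, 312), (498, 331), (528, 332)]),
     ((6, 16), [(207, 416), (253, 420), (297, 408), (343, 382), (355, 406), (348, 449), (352,
     489), (371, 525), (359, 559), (368, 590), (368, 624), (317, 624), (310, 662), (321, 693)]),
     ((7, 8), [(586, 283), (600, 258), (565, 223), (555, 170), (576, 151), (609, 133), (604, 99),
     (645, 86), (687, 80), (706, 76), (745, 56), (770, 76), (813, 95), (827, 127)]),
     ((7, 17), [(512, 258), (490, 236), (437, 247), (400, 259), (391, 206), (376, 200), (335,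
     185), (351, 141), (405, 136), (428, 121), (466, 125), (514, 120), (507, 73), (483, 68)]),
     ((8, 9), [(813, 201), (796, 241), (770, 281), (796, 307), (755, 336), (726, 354), (743, 405),
     (781, 404), (805, 445), (826, 456), (880, 461), (909, 420), (879, 400), (862, 360)]),
     ((8, 18), [(762, 144), (718, 166), (717, 216), (663, 215), (673, 255), (661, 278), (657,
     311), (650, 334), (653, 370), (675, 419), (699, 464), (706, 487), (674, 523), (640, 511)]),
     ((9, 19), [(865, 295), (886, 268), (873, 223), (867, 180), (892, 134), (922, 139), (969,
     148), (981, 198), (1019, 217), (1057, 239), (1083, 238), (1092, 289), (1126, 288), (1153,
     285)]),
     ((10, 12), [(845, 618), (888, 646), (906, 644), (943, 612), (980, 581), (1013, 557), (1049,
     564), (1064, 596), (1052, 644), (1013, 646), (1007, 679), (1042, 721), (993, 738), (940,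
     744)]),
     ((10, 18), [(774, 599), (727, 610), (693, 606), (657, 635), (652, 685), (635, 701), (595,
     706), (578, 673), (531, 655), (535, 607), (525, 590), (527, 544), (547, 511), (573, 511)]),
     ((11, 13), [(1154, 1086), (1116, 1126), (1075, 1162), (1032, 1196), (986, 1226), (937, 1251),
     (886, 1272), (833, 1289), (780, 1301), (725, 1309), (671, 1313), (616, 1312), (561, 1306),
     (507, 1296)]),
     ((11, 19), [(1220, 998), (1245, 949), (1267, 899), (1284, 847), (1298, 793), (1307, 739),
     (1312, 684), (1312, 629), (1308, 575), (1299, 520), (1287, 467), (1269, 414), (1245, 365),
     (1218, 317)]),
     ((12, 14), [(887, 773), (863, 745), (864, 697), (810, 702), (807, 735), (763, 738), (730,
     708), (703, 722), (687, 745), (690, 778), (699, 803), (699, 840), (711, 881), (691, 905)]),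
     ((13, 15), [(402, 1263), (353, 1239), (305, 1211), (260, 1179), (218, 1144), (178, 1106),
     (142, 1064), (110, 1020), (81, 973), (55, 924), (36, 873), (20, 820), (8, 767), (1, 712)]),
     ((14, 16), [(629, 872), (643, 820), (624, 798), (587, 828), (540, 809), (527, 793), (504,
     753), (467, 727), (443, 753), (415, 797), (386, 820), (350, 802), (345, 767), (374, 744)]),
     ((15, 17), [(3, 602), (10, 548), (21, 494), (37, 441), (57, 390), (82, 341), (110, 294),
     (142, 249), (178, 207), (218, 169), (260, 134), (305, 103), (353, 75), (403, 52)]),
     ((16, 18), [(402, 677), (419, 663), (466, 647), (459, 599), (444, 554), (464, 517), (479,
     474), (458, 449), (477, 417), (497, 391), (545, 387), (550, 430), (582, 446), (613, 454)]),
     ((17, 19), [(507, 16), (561, 7), (616, 1), (671, 0), (726, 2), (780, 11), (833, 24), (885,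
     42), (936, 63), (985, 89), (1031, 118), (1075, 151), (1116, 188), (1154, 228)])]"

text \<open>The lists are keyed by the orientation used in the names of inner vertices and begin
  with the vertex at \<open>i = 1\<close>.\<close>

fun position :: "nat subdiv_vertex \<Rightarrow> int \<times> int" where
  "position (Branch u) = branch_positions ! u"
| "position (Inner u v i) = the (map_of edge_positions (u, v)) ! (i - 1)"

section \<open>Checking the drawing in integer arithmetic\<close>

definition sq_dist :: "int \<times> int \<Rightarrow> int \<times> int \<Rightarrow> int" where
  "sq_dist = (\<lambda>(a, b) (c, d). (a - c) * (a - c) + (b - d) * (b - d))"

text \<open>The clause \<open>p \<noteq> q\<close> makes the same check yield injectivity, since
  coinciding points have squared distance 0.\<close>

definition well_placed ::
  "nat subdiv_vertex \<times> int \<times> int \<Rightarrow> nat subdiv_vertex \<times> int \<times> int \<Rightarrow> bool" where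
  "well_placed = (\<lambda>(x, p) (y, q). sq_dist p q \<le> 3136 \<longrightarrow> p \<noteq> q \<and> subdiv_adjacent 15 x y)"

definition placed_vertices :: "(nat subdiv_vertex \<times> int \<times> int) list" where
  "placed_vertices = zip (map Branch [0..<20]) branch_positions @
    concat (map (\<lambda>((u, v), ps). zip (map (Inner u v) [1..<15]) ps) edge_positions)"

text \<open>
  Two elements whose \<open>f\<close>-values differ by at most \<open>56\<close> stay together on one side of every pivot
  \<open>p\<close>, so that \<open>Q\<close> has to be checked only for the short lists at the leaves.
\<close>

fun bisect :: "('b \<Rightarrow> int) \<Rightarrow> ('b list \<Rightarrow> bool) \<Rightarrow> int \<Rightarrow> int list \<Rightarrow> 'b list \<Rightarrow> bool" where
  "bisect f Q p [] zs = Q zs"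
| "bisect f Q p (w # ws) zs =
    (bisect f Q (p - w) ws (filter (\<lambda>z. f z \<le> p + 56) zs) \<and>
     bisect f Q (p + w) ws (filter (\<lambda>z. p < f z) zs))"

lemma bisectD:
  assumes "bisect f Q p ws zs" "a \<in> set zs" "b \<in> set zs" "\<bar>f a - f b\<bar> \<le> 56"
  shows "\<exists>zs'. Q zs' \<and> a \<in> set zs' \<and> b \<in> set zs'"
  using assms
proof (induction ws arbitrary: p zs)
  case (Cons w ws)
  show ?case
  proof (cases "f a \<le> p + 56 \<and> f b \<le> p + 56")
    case True
    with Cons.prems Cons.IH[of "p - w" "filter (\<lambda>z. f z \<le> p + 56) zs"] show ?thesis by simp
  next
    case False
    then have "p < f a" "p < f b" using Cons.prems(4) by linarith+
    with Cons.prems Cons.IH[of "p + w" "filter (\<lambda>z. p < f z) zs"] show ?thesis by simp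
  qed
qed auto

text \<open>The coordinates lie between 0 and 1313, with middle 656. Four halvings per coordinate
  give sixteen overlapping strips, so the nearly 100000 pairs of points need not all be
  compared.\<close>

lemma placed_vertices_well_placed:
  "bisect (fst \<circ> snd) (bisect (snd \<circ> snd) (sorted_wrt well_placed) 656 [328, 164, 82, 41])
    656 [328, 164, 82, 41] placed_vertices"
  by code_simp

lemma edge_positions_short:
  "\<forall>(u, v)\<in>set (filter (\<lambda>(u, v). u < v) dodecahedron_arcs).
    (case map_of edge_positions (u, v) of None \<Rightarrow> False | Some ps \<Rightarrow> length ps = 14 \<and>
      successively (\<lambda>p q. sq_dist p q \<le> 3136) (branch_positions ! u # ps @ [branch_positions ! v]))"
  by code_simp

lemma sq_dist_commute: "sq_dist p q = sq_dist q p"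
  by (cases p; cases q) (simp add: sq_dist_def algebra_simps)

lemma subdiv_adjacent_commute: "subdiv_adjacent k x y \<longleftrightarrow> subdiv_adjacent k y x"
  by (cases x; cases y) auto

lemma well_placed_commute: "well_placed z z' \<longleftrightarrow> well_placed z' z"
  using sq_dist_commute subdiv_adjacent_commute by (cases z; cases z') (auto simp: well_placed_def)

lemma length_branch_positions: "length branch_positions = 20"
  by (simp add: branch_positions_def)

lemma edge_positions_arc:
  assumes "(u, v) \<in> parcs dodecahedron_graph" "u < v"
  obtains ps where "map_of edge_positions (u, v) = Some ps" "length ps = 14"
    "successively (\<lambda>p q. sq_dist p q \<le> 3136) (branch_positions ! u # ps @ [branch_positions ! v])"
  using edge_positions_short assms
  by (fastforce simp: parcs_dodecahedron_graph split: option.splits)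

lemma position_in_placed_vertices:
  assumes "x \<in> pverts dodecahedron.H"
  shows "(x, position x) \<in> set placed_vertices"
proof -
  consider u where "x = Branch u" "u < 20"
    | u v i where "x = Inner u v i" "(u, v) \<in> parcs dodecahedron_graph" "u < v" "0 < i" "i < 15"
    using assms by (auto simp: dodecahedron.pverts_H pverts_dodecahedron_graph)
  then show ?thesis
  proof cases
    case 1
    then have "(x, position x) \<in> set (zip (map Branch [0..<20]) branch_positions)"
      unfolding in_set_zip by (intro exI[of _ u]) (simp add: length_branch_positions)
    then show ?thesis by (simp add: placed_vertices_def)
  next
    case 2
    obtain ps where ps: "map_of edge_positions (u, v) = Some ps" "length ps = 14"
      using edge_positions_arc[OF 2(2,3)] .
    have "(x, position x) \<in> set (zip (map (Inner u v) [1..<15]) ps)"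
      unfolding in_set_zip using 2 ps by (intro exI[of _ "i - 1"]) (auto simp: nth_append)
    with map_of_SomeD[OF ps(1)] show ?thesis by (force simp: placed_vertices_def)
  qed
qed

lemma well_placed_positions:
  assumes "x \<in> pverts dodecahedron.H" "y \<in> pverts dodecahedron.H" "x \<noteq> y"
    "sq_dist (position x) (position y) \<le> 3136"
  shows "position x \<noteq> position y" "(x, y) \<in> parcs dodecahedron.H"
proof -
  let ?x = "(x, position x)" and ?y = "(y, position y)"
  have abs_le: "\<bar>a\<bar> \<le> 56" if "a * a + b * b \<le> 3136" for a b :: int
  proof -
    have "a\<^sup>2 \<le> 56\<^sup>2" using that by (simp add: power2_eq_square) (smt (verit) zero_le_square)
    then show ?thesis using abs_le_square_iff[of a 56] by simp
  qed
  have "\<bar>fst (position x) - fst (position y)\<bar> \<le> 56" "\<bar>snd (position x) - snd (position y)\<bar> \<le> 56"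
    using assms(4) abs_le[of "fst (position x) - fst (position y)" "snd (position x) - snd (position y)"]
      abs_le[of "snd (position x) - snd (position y)" "fst (position x) - fst (position y)"]
    by (auto simp: sq_dist_def case_prod_unfold add.commute)
  then obtain zs where zs: "bisect (snd \<circ> snd) (sorted_wrt well_placed) 656 [328, 164, 82, 41] zs"
    "?x \<in> set zs" "?y \<in> set zs" "\<bar>(snd \<circ> snd) ?x - (snd \<circ> snd) ?y\<bar> \<le> 56"
    using bisectD[OF placed_vertices_well_placed position_in_placed_vertices[OF assms(1)]
        position_in_placed_vertices[OF assms(2)]] by auto
  from bisectD[OF zs] obtain zs' where "sorted_wrt well_placed zs'" "?x \<in> set zs'" "?y \<in> set zs'"
    by blast
  then obtain i j where "i < length zs'" "j < length zs'" "zs' ! i = ?x" "zs' ! j = ?y"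
    by (metis in_set_conv_nth)
  moreover from this have "i \<noteq> j" using assms(3) by auto
  \<comment> \<open>\<open>sorted_wrt\<close> covers each pair in list order only; symmetry of
    \<open>well_placed\<close> supplies the other order.\<close>
  ultimately have "well_placed ?x ?y"
    using \<open>sorted_wrt well_placed zs'\<close> well_placed_commute
    by (metis linorder_neqE_nat sorted_wrt_nth_less)
  with assms show "position x \<noteq> position y" "(x, y) \<in> parcs dodecahedron.H"
    by (auto simp: well_placed_def intro!: dodecahedron.subdiv_adjacent_arc)
qed

lemma position_arc:
  assumes "(x, y) \<in> parcs dodecahedron.H"
  shows "sq_dist (position x) (position y) \<le> 3136"
proof -
  have short: "sq_dist (position (subdiv_point 15 u v i)) (position (subdiv_point 15 u v (Suc i))) \<le> 3136"
    if uv: "(u, v) \<in> parcs dodecahedron_graph" "u < v" "i < 15" for u v i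
  proof -
    obtain ps where ps: "map_of edge_positions (u, v) = Some ps" "length ps = 14"
      "successively (\<lambda>p q. sq_dist p q \<le> 3136) (branch_positions ! u # ps @ [branch_positions ! v])"
      using edge_positions_arc[OF uv(1,2)] .
    have "position (subdiv_point 15 u v j) = (branch_positions ! u # ps @ [branch_positions ! v]) ! j"
      if "j \<le> 15" for j
      using that uv ps(1,2) by (auto simp: subdiv_point_def nth_Cons' nth_append)
    then show ?thesis using ps uv by (simp add: successively_conv_nth)
  qed
  obtain u v i where i: "(u, v) \<in> parcs dodecahedron_graph" "i < 15"
    "x = subdiv_point 15 u v i" "y = subdiv_point 15 u v (Suc i)"
    using assms dodecahedron.parcs_H by blast
  show ?thesis
  proof (cases "u < v")
    case True
    with i short show ?thesis by simp
  next
    case False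
    then have "v < u" "(v, u) \<in> parcs dodecahedron_graph"
      using i dodecahedron.arc_neq dodecahedron.arc_sym by (auto simp: not_less le_less)
    \<comment> \<open>Step \<open>i\<close> from \<open>u\<close> is step \<open>14 - i\<close> from
      \<open>v\<close>, traversed backwards.\<close>
    moreover have "Suc (14 - i) = 15 - i" using i(2) by simp
    ultimately show ?thesis
      using short[of v u "14 - i"] i dodecahedron.point_swap[OF i(1), of i]
        dodecahedron.point_swap[OF i(1), of "Suc i"]
      by (simp add: sq_dist_commute)
  qed
qed

section \<open>From integer coordinates to the Euclidean plane\<close>

definition plane_point :: "int \<times> int \<Rightarrow> real ^ 2" where
  "plane_point p = vector [of_int (fst p), of_int (snd p)]"

lemma dist_plane_point: "dist (plane_point p) (plane_point q) \<le> 56 \<longleftrightarrow> sq_dist p q \<le> 3136"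
proof -
  have "dist (plane_point p) (plane_point q) = sqrt (of_int (sq_dist p q))"
    by (simp add: dist_vec_def L2_set_def sum_2 plane_point_def dist_real_def sq_dist_def
        case_prod_unfold power2_eq_square)
  moreover have "sqrt (of_int (sq_dist p q)) \<le> 56 \<longleftrightarrow> real_of_int (sq_dist p q) \<le> 56\<^sup>2"
    using real_sqrt_le_iff[of "of_int (sq_dist p q)" "56\<^sup>2"] by simp
  ultimately show ?thesis by simp
qed

lemma plane_point_eq_iff: "plane_point p = plane_point q \<longleftrightarrow> p = q"
  by (auto simp: plane_point_def vec_eq_iff forall_2 prod_eq_iff)

theorem geometric_representation: "admits_geometric_representation dodecahedron.H"
proof -
  let ?H = dodecahedron.H and ?f = "\<lambda>x. plane_point (position x)"
  have inj: "inj_on ?f (pverts ?H)"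
  proof (rule inj_onI, rule ccontr)
    fix x y assume xy: "x \<in> pverts ?H" "y \<in> pverts ?H" "?f x = ?f y" "x \<noteq> y"
    then have "sq_dist (position x) (position y) \<le> 3136"
      by (simp add: plane_point_eq_iff sq_dist_def case_prod_unfold)
    with well_placed_positions(1)[OF xy(1,2,4)] xy(3) show False by (simp add: plane_point_eq_iff)
  qed
  have arcs: "dist (?f x) (?f y) \<le> 56 \<longleftrightarrow> (x, y) \<in> parcs ?H"
    if "x \<in> pverts ?H" "y \<in> pverts ?H" "x \<noteq> y" for x y
    unfolding dist_plane_point using that well_placed_positions(2) position_arc by blast
  have "parcs (geometric_graph (?f ` pverts ?H) 56) = map_prod ?f ?f ` parcs ?H"
  proof (intro equalityI subsetI)
    fix e assume "e \<in> parcs (geometric_graph (?f ` pverts ?H) 56)"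
    then obtain x y where "e = (?f x, ?f y)" "x \<in> pverts ?H" "y \<in> pverts ?H" "x \<noteq> y"
      "dist (?f x) (?f y) \<le> 56"
      by (auto simp: geometric_graph_def)
    with arcs show "e \<in> map_prod ?f ?f ` parcs ?H" by force
  next
    fix e assume "e \<in> map_prod ?f ?f ` parcs ?H"
    then obtain x y where e: "(x, y) \<in> parcs ?H" "e = (?f x, ?f y)" by auto
    then have xy: "x \<in> pverts ?H" "y \<in> pverts ?H" "x \<noteq> y"
      using dodecahedron.H.in_arcsD1 dodecahedron.H.in_arcsD2 dodecahedron.H.pair_no_loops by fastforce+
    moreover from xy have "?f x \<noteq> ?f y" using inj_onD[OF inj] by blast
    ultimately show "e \<in> parcs (geometric_graph (?f ` pverts ?H) 56)"
      using e arcs[OF xy] by (simp add: geometric_graph_def)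
  qed
  moreover have "bij_betw ?f (pverts ?H) (pverts (geometric_graph (?f ` pverts ?H) 56))"
    using inj by (simp add: bij_betw_def geometric_graph_def)
  ultimately have "digraph_iso (with_proj ?H) (with_proj (geometric_graph (?f ` pverts ?H) 56))"
    using digraph_iso_with_proj_iff[OF dodecahedron.H.pair_wf_digraph_axioms] by blast
  moreover have "finite (?f ` pverts ?H)" using dodecahedron.H.pair_finite_verts by simp
  ultimately show ?thesis
    unfolding admits_geometric_representation_def
    by (intro exI[of _ "?f ` pverts ?H"] exI[of _ 56]) simp
qed

theorem theoremC:
  "cop_number (subdivide_edges 15 dodecahedron_graph) = 3
    \<and> admits_geometric_representation (subdivide_edges 15 dodecahedron_graph)"
  using cop_number_dodecahedron geometric_representation by blast

end
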